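(* Let $k,n\in\mathbb N$ with $1\le k\le n$, let $\lambda\vdash n$ and $x\in\lambda$. Then the map $$\Psi:\operatorname{T}(\lambda,k\to x)\times\{k,\dots,n\}\to\operatorname{H}(\lambda)\times\operatorname{SYT}(\lambda,x\ge k),\qquad (T,l)\mapsto\Phi((k\,l)\circ T),$$ is well defined and a bijection, where $(k\,l)\in\mathfrak S_n$ is the transposition of the values $k$ and $l$ (the identity if $l=k$) and $\Phi$ is the Novelli--Pak--Stoyanovskii bijection.
   Context: A partition $\lambda\vdash n$ is identified with its Young diagram $\{(i,j): i\ge1,\ 1\le j\le\lambda_i\}$; $\lambda'$ is its conjugate. Arm and leg of $x=(i,j)$: $\operatorname{arm}(x)=\lambda_i-j$, $\operatorname{leg}(x)=\lambda'_j-i$. A hook tableau is a map $H:\lambda\to\mathbb Z$ with $-\operatorname{leg}(x)\le H(x)\le\operatorname{arm}(x)$ for all $x$; $\operatorname{H}(\lambda)$ is their set. A tabloid is a bijection $T:\lambda\to\{1,\dots,n\}$; $\operatorname{T}(\lambda)$ is their set, acted on by $\mathfrak S_n$ via $\sigma\circ T$. A standard Young tableau is a tabloid with entries increasing along rows and down columns; $\operatorname{SYT}(\lambda,x\ge k)$ is the set of standard Young tableaux $U$ of shape $\lambda$ with $U(x)\ge k$. Order cells by $(i,j)\prec(k,l)$ iff $j<l$, or $j=l$ and $i<k$; list them $z_1\prec\dots\prec z_n$. Novelli--Pak--Stoyanovskii sorting of $T$: $T_{z_n}:=T$; for $m=n-1,\dots,1$, $T_{z_m}$ is obtained from $T_{z_{m+1}}$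 by the slide at $z_m$, which repeatedly exchanges the entry in $z_m$ with the smaller of the entries in its current right and bottom neighbours as long as that entry is smaller than it. $\operatorname{T}(\lambda,k\to x)$ is the set of $T\in\operatorname{T}(\lambda)$ such that, with $T(z)=k$, $T_z(x)=k$ (the entry $k$ is moved to $x$ by its own slide). The Novelli--Pak--Stoyanovskii bijection $\Phi:\operatorname{T}(\lambda)\to\operatorname{H}(\lambda)\times\operatorname{SYT}(\lambda)$ maps $T$ to $(H,U)$ with $U=T_{z_1}$ the sorted output, and $H$ built alongside: start with $H\equiv0$; when the slide at $z_m=(a,b)$ moves the entry from $(a,b)$ to its final cell $(a',b')$, replace $H(c,b)$ by the old value of $H(c+1,b)$ minus $1$ for $a\le c<a'$, and set $H(a',b):=b'-b$. $\Phi$ is a bijection. *)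

theory Defs
  imports Main "HOL-Combinatorics.Transposition"
begin

type_synonym cell = "nat \<times> nat"

definition is_partition :: "nat list \<Rightarrow> nat \<Rightarrow> bool" where
  "is_partition lam n \<longleftrightarrow> sorted_wrt (\<ge>) lam \<and> (\<forall>p\<in>set lam. 0 < p) \<and> sum_list lam = n"

definition rowlen :: "nat list \<Rightarrow> nat \<Rightarrow> nat" where
  "rowlen lam i = (if 1 \<le> i \<and> i \<le> length lam then lam ! (i - 1) else 0)"

definition collen :: "nat list \<Rightarrow> nat \<Rightarrow> nat" where
  "collen lam j = length (filter (\<lambda>p. j \<le> p) lam)"

definition diagram :: "nat list \<Rightarrow> cell set" where
  "diagram lam = {(i, j). 1 \<le> i \<and> 1 \<le> j \<and> j \<le> rowlen lam i}"

definition arm :: "nat list \<Rightarrow> cell \<Rightarrow> nat" where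
  "arm lam x = rowlen lam (fst x) - snd x"

definition leg :: "nat list \<Rightarrow> cell \<Rightarrow> nat" where
  "leg lam x = collen lam (snd x) - fst x"

definition hook_tableaux :: "nat list \<Rightarrow> (cell \<Rightarrow> int) set" where
  "hook_tableaux lam = {H. (\<forall>x\<in>diagram lam. - int (leg lam x) \<le> H x \<and> H x \<le> int (arm lam x))
                          \<and> (\<forall>x. x \<notin> diagram lam \<longrightarrow> H x = 0)}"

definition tabloids :: "nat list \<Rightarrow> (cell \<Rightarrow> nat) set" where
  "tabloids lam = {T. bij_betw T (diagram lam) {1..sum_list lam}
                      \<and> (\<forall>x. x \<notin> diagram lam \<longrightarrow> T x = 0)}"

definition SYT :: "nat list \<Rightarrow> (cell \<Rightarrow> nat) set" where
  "SYT lam = {U\<in>tabloids lam.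
      (\<forall>i j. (i, j) \<in> diagram lam \<and> (i, Suc j) \<in> diagram lam \<longrightarrow> U (i, j) < U (i, Suc j))
    \<and> (\<forall>i j. (i, j) \<in> diagram lam \<and> (Suc i, j) \<in> diagram lam \<longrightarrow> U (i, j) < U (Suc i, j))}"

definition SYT_ge :: "nat list \<Rightarrow> cell \<Rightarrow> nat \<Rightarrow> (cell \<Rightarrow> nat) set" where
  "SYT_ge lam x k = {U\<in>SYT lam. k \<le> U x}"

definition cells :: "nat list \<Rightarrow> cell list" where
  "cells lam = concat (map (\<lambda>j. map (\<lambda>i. (i, j)) [1..<Suc (collen lam j)])
                           [1..<Suc (rowlen lam 1)])"

text \<open>The slide at a cell (with a fuel argument bounding the number of exchanges);
  returns the new filling and the final cell of the moving entry.\<close>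
fun slide :: "nat \<Rightarrow> nat list \<Rightarrow> (cell \<Rightarrow> nat) \<Rightarrow> cell \<Rightarrow> (cell \<Rightarrow> nat) \<times> cell" where
  "slide 0 lam T c = (T, c)"
| "slide (Suc f) lam T (a, b) =
     (let R = ((a, Suc b) \<in> diagram lam); B = ((Suc a, b) \<in> diagram lam);
          y = (if R \<and> B then (if T (a, Suc b) < T (Suc a, b) then (a, Suc b) else (Suc a, b))
               else if R then (a, Suc b) else (Suc a, b))
      in if (R \<or> B) \<and> T y < T (a, b)
         then slide f lam (T((a, b) := T y, y := T (a, b))) y
         else (T, (a, b)))"

definition nps_step :: "nat list \<Rightarrow> (cell \<Rightarrow> nat) \<times> (cell \<Rightarrow> int) \<Rightarrow> cell
                        \<Rightarrow> (cell \<Rightarrow> nat) \<times> (cell \<Rightarrow> int)" where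
  "nps_step lam TH c =
     (let T = fst TH; H = snd TH; a = fst c; b = snd c;
          r = slide (sum_list lam) lam T c; a' = fst (snd r); b' = snd (snd r)
      in (fst r, (\<lambda>(p, q). if q = b \<and> a \<le> p \<and> p < a' then H (Suc p, b) - 1
                          else if (p, q) = (a', b) then int b' - int b
                          else H (p, q))))"

definition nps_run :: "nat list \<Rightarrow> (cell \<Rightarrow> nat) \<times> (cell \<Rightarrow> int) \<Rightarrow> cell list
                       \<Rightarrow> (cell \<Rightarrow> nat) \<times> (cell \<Rightarrow> int)" where
  "nps_run lam TH cs = foldl (nps_step lam) TH cs"

text \<open>The intermediate filling T_z (z = z_m): T_{z_n} = T, then slides at z_{n-1}, ..., z_m.\<close>
definition nps_state :: "nat list \<Rightarrow> (cell \<Rightarrow> nat) \<Rightarrow> cell \<Rightarrow> (cell \<Rightarrow> nat)" where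
  "nps_state lam T z =
     fst (nps_run lam (T, \<lambda>_. 0) (rev (dropWhile (\<lambda>c. c \<noteq> z) (butlast (cells lam)))))"

definition Phi :: "nat list \<Rightarrow> (cell \<Rightarrow> nat) \<Rightarrow> (cell \<Rightarrow> int) \<times> (cell \<Rightarrow> nat)" where
  "Phi lam T = (let r = nps_run lam (T, \<lambda>_. 0) (rev (butlast (cells lam))) in (snd r, fst r))"

definition T_to :: "nat list \<Rightarrow> nat \<Rightarrow> cell \<Rightarrow> (cell \<Rightarrow> nat) set" where
  "T_to lam k x = {T\<in>tabloids lam. \<forall>z\<in>diagram lam. T z = k \<longrightarrow> nps_state lam T z x = k}"

end

theory Submission
  imports Defs "HOL-Library.FuncSet"
begin

text \<open>
  Bijectivity of \<open>\<Phi>\<close>: the slide path is recovered from its final cell by walking back to the larger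
  of the upper and left neighbours. Every nonnegative hook value in the current column encodes a
  candidate for this final cell, and the true one is the candidate whose reverse path runs weakly
  to the right of all others. If the reverse paths of all candidates return to the current
  cell, undoing the slide keeps this property, because in the unsorted filling no reverse path
  changes sides of the slide path. For a complete column the property holds trivially.

  The theorem: call an entry small if it is less than \<open>k\<close>. How the small entries move depends only
  on their positions, and each slide of a big entry adds one cell \<open>y\<close> to the set of sorted cells
  with big entries, namely the cell where \<open>k\<close> would stop in its place. So the sorted output has a big
  entry in \<open>x\<close> iff \<open>y = x\<close> for some big entry \<open>l\<close> of the input, and then \<open>l\<close> is unique.
\<close>

section \<open>Diagrams and slides\<close>

text \<open>While column \<open>b\<close> is only partly processed, a sorted filling with hook
  values in range need not arise from the algorithm. The reachability condition in
  \<open>stage\<close> cuts out exactly the image, so each single slide becomes a bijection. At the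
  top of a column the condition is automatic because cells outside the diagram carry 0: in row 1 a
  reverse path can only walk left until column \<open>b\<close>. The slide path wins for the
  following reason. An old candidate \<open>(i+1, c)\<close> in a row of the path lies weakly left
  of it and is recoded as \<open>(i, c-1)\<close>, hence strictly left of the last path cell in row
  \<open>i\<close>; candidates below the path keep their code. This explains the mixture of strict
  and weak inequalities in \<open>dominant\<close>. In the second half the transposition changes big
  entries in all intermediate fillings, so fillings are compared only up to their big entries.
  Uniqueness of \<open>l\<close> comes from counting: there are \<open>n-k+1\<close> big entries
  before and after sorting, and each big cell of the output is a stopping cell of \<open>k\<close>
  for some big cell of the input.\<close>

definition adj :: "cell \<Rightarrow> cell \<Rightarrow> bool" where
  "adj u v \<longleftrightarrow> v = (fst u, Suc (snd u)) \<or> v = (Suc (fst u), snd u)"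

lemma adj_simps [simp]:
  "adj (p, q) (p', q') \<longleftrightarrow> p' = p \<and> q' = Suc q \<or> p' = Suc p \<and> q' = q"
  by (auto simp: adj_def)

lemma adj_neq: "adj u v \<Longrightarrow> u \<noteq> v"
  by (cases u, cases v) auto

lemma adj_asym: "adj u v \<Longrightarrow> \<not> adj v u"
  by (cases u, cases v) auto

text \<open>Hides the choice between right and bottom neighbour, including the tie rule, behind
  minimality among the \<open>adj\<close> successors. For injective fillings minimality determines
  \<open>y\<close>.\<close>

lemma slide_cases:
  obtains (stop) "slide (Suc f) lam T c = (T, c)"
      "\<And>v. adj c v \<Longrightarrow> v \<in> diagram lam \<Longrightarrow> T c \<le> T v"
  | (move) y where "adj c y" "y \<in> diagram lam" "T y < T c"
      "\<And>v. adj c v \<Longrightarrow> v \<in> diagram lam \<Longrightarrow> T y \<le> T v"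
      "slide (Suc f) lam T c = slide f lam (T(c := T y, y := T c)) y"
proof -
  obtain a b where c: "c = (a, b)" by (cases c)
  define R where "R = ((a, Suc b) \<in> diagram lam)"
  define B where "B = ((Suc a, b) \<in> diagram lam)"
  define y where "y = (if R \<and> B then (if T (a, Suc b) < T (Suc a, b) then (a, Suc b) else (Suc a, b))
               else if R then (a, Suc b) else (Suc a, b))"
  have sl: "slide (Suc f) lam T c = (if (R \<or> B) \<and> T y < T (a, b)
         then slide f lam (T((a, b) := T y, y := T (a, b))) y
         else (T, (a, b)))"
    by (simp only: c slide.simps Let_def R_def B_def y_def)
  have min: "T y \<le> T v" if "adj c v" "v \<in> diagram lam" for v
    using that unfolding y_def R_def B_def c adj_def by auto
  have nb: "R \<or> B" if "adj c v" "v \<in> diagram lam" for v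
    using that unfolding R_def B_def c adj_def by auto
  show thesis
  proof (cases "(R \<or> B) \<and> T y < T c")
    case True
    then have "adj c y" "y \<in> diagram lam"
      unfolding y_def R_def B_def c adj_def by auto
    then show ?thesis
      using True sl min c by (intro move[of y]) auto
  next
    case False
    have "T c \<le> T v" if "adj c v" "v \<in> diagram lam" for v
      using False nb[OF that] min[OF that] by auto
    moreover have "slide (Suc f) lam T c = (T, c)"
      using False sl c by auto
    ultimately show ?thesis by (intro stop) auto
  qed
qed

lemma slide_stopI:
  assumes "\<And>v. adj c v \<Longrightarrow> v \<in> diagram lam \<Longrightarrow> T c \<le> T v"
  shows "slide f lam T c = (T, c)"
proof (cases f)
  case (Suc g)
  show ?thesis
    unfolding Suc by (rule slide_cases[of g lam T c]) (use assms in \<open>auto simp: not_less[symmetric]\<close>)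
qed simp

lemma slide_moveI:
  assumes "adj c y" "y \<in> diagram lam" "T y < T c"
    and "\<And>v. adj c v \<Longrightarrow> v \<in> diagram lam \<Longrightarrow> v \<noteq> y \<Longrightarrow> T y < T v"
  shows "slide (Suc f) lam T c = slide f lam (T(c := T y, y := T c)) y"
proof (rule slide_cases[of f lam T c])
  assume "\<And>v. adj c v \<Longrightarrow> v \<in> diagram lam \<Longrightarrow> T c \<le> T v"
  then show ?thesis using assms by (auto simp: not_less[symmetric])
next
  fix y' assume y': "adj c y'" "y' \<in> diagram lam"
    "\<And>v. adj c v \<Longrightarrow> v \<in> diagram lam \<Longrightarrow> T y' \<le> T v"
    and sl: "slide (Suc f) lam T c = slide f lam (T(c := T y', y' := T c)) y'"
  have "y' = y" using y' assms by (meson not_less)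
  then show ?thesis using sl by simp
qed

lemma tabloid_swap:
  assumes "T \<in> tabloids lam" "c \<in> diagram lam" "y \<in> diagram lam"
  shows "T(c := T y, y := T c) \<in> tabloids lam"
proof -
  have eq: "T(c := T y, y := T c) = T \<circ> transpose c y"
    by (auto simp: fun_eq_iff transpose_def)
  have "bij_betw (transpose c y) (diagram lam) (diagram lam)"
    using assms by (intro bij_betwI[of _ _ _ "transpose c y"]) (auto simp: transpose_def)
  then show ?thesis
    using assms unfolding tabloids_def eq by (auto intro!: bij_betw_trans simp: transpose_def)
qed

lemma tabloid_inj: "T \<in> tabloids lam \<Longrightarrow> inj_on T (diagram lam)"
  by (simp add: tabloids_def bij_betw_def)

lemma slide_tabloid:
  assumes "T \<in> tabloids lam" "c \<in> diagram lam"
  shows "fst (slide f lam T c) \<in> tabloids lam"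
  using assms
proof (induction f arbitrary: T c)
  case (Suc f)
  show ?case
    by (rule slide_cases[of f lam T c]) (use Suc in \<open>auto intro!: Suc.IH tabloid_swap\<close>)
qed simp

lemma slide_unchanged:
  assumes "\<not> (fst c \<le> fst u \<and> snd c \<le> snd u)"
  shows "fst (slide f lam T c) u = T u"
  using assms
proof (induction f arbitrary: T c)
  case (Suc f)
  show ?case
  proof (rule slide_cases[of f lam T c])
    fix y assume y: "adj c y" and sl: "slide (Suc f) lam T c = slide f lam (T(c := T y, y := T c)) y"
    have "\<not> (fst y \<le> fst u \<and> snd y \<le> snd u)" "u \<noteq> c" "u \<noteq> y"
      using Suc.prems y by (auto simp: adj_def)
    then show ?thesis using Suc.IH[of y] sl by simp
  qed simp
qed simp

text \<open>A slide path occupies, in each row \<open>p\<close> from its first row \<open>r\<close> to its last row \<open>a\<close>,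
  the columns \<open>m p\<close>, \dots, \<open>m (Suc p)\<close>; so \<open>(a, m (Suc a))\<close> is its final cell.\<close>
definition shift :: "nat \<Rightarrow> (nat \<Rightarrow> nat) \<Rightarrow> nat \<Rightarrow> (cell \<Rightarrow> nat) \<Rightarrow> cell \<Rightarrow> nat" where
  "shift r m a T = (\<lambda>(p, q).
     if r \<le> p \<and> p \<le> a \<and> m p \<le> q \<and> q < m (Suc p) then T (p, Suc q)
     else if r \<le> p \<and> p < a \<and> q = m (Suc p) then T (Suc p, q)
     else if p = a \<and> q = m (Suc a) then T (r, m r)
     else T (p, q))"

lemma slide_shift:
  assumes "(r, b) \<in> diagram lam"
  obtains m a where "m r = b" "r \<le> a" "\<And>p. r \<le> p \<Longrightarrow> p \<le> a \<Longrightarrow> m p \<le> m (Suc p)"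
    "(a, m (Suc a)) \<in> diagram lam" "slide f lam T (r, b) = (shift r m a T, (a, m (Suc a)))"
  using assms
proof (induction f arbitrary: T r b thesis)
  case 0
  show ?case
    by (rule 0(1)[of "\<lambda>_. b" r]) (use 0 in \<open>auto simp: shift_def fun_eq_iff\<close>)
next
  case (Suc f)
  show ?case
  proof (rule slide_cases[of f lam T "(r, b)"])
    assume "slide (Suc f) lam T (r, b) = (T, r, b)"
    then show ?case
      by (intro Suc(2)[of "\<lambda>_. b" r]) (use Suc(3) in \<open>auto simp: shift_def fun_eq_iff\<close>)
  next
    fix y assume y: "adj (r, b) y" "y \<in> diagram lam"
      and sl: "slide (Suc f) lam T (r, b) = slide f lam (T((r, b) := T y, y := T (r, b))) y"
    obtain r' b' where yy: "y = (r', b')" by (cases y)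
    obtain m a where m: "m r' = b'" "r' \<le> a" "\<And>p. r' \<le> p \<Longrightarrow> p \<le> a \<Longrightarrow> m p \<le> m (Suc p)"
      "(a, m (Suc a)) \<in> diagram lam"
      "slide f lam (T((r, b) := T y, y := T (r, b))) (r', b') =
         (shift r' m a (T((r, b) := T y, y := T (r, b))), (a, m (Suc a)))"
      using Suc.IH[of r' b'] y yy by blast
    have r': "r' = r \<and> b' = Suc b \<or> r' = Suc r \<and> b' = b" using y yy by auto
    \<comment> \<open>Prepending \<open>(r, b)\<close> to the path: after a step right the first
      column of row \<open>r\<close> drops from \<open>Suc b\<close> to \<open>b\<close>; after a
      step down row \<open>r\<close> is new and consists of \<open>(r, b)\<close> alone.\<close>
    let ?m = "m(r := b)"
    have mono: "?m p \<le> ?m (Suc p)" if "r \<le> p" "p \<le> a" for p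
    proof (cases "p = r")
      case True
      then show ?thesis using r' m(1) m(3)[of r] that by auto
    next
      case False
      then show ?thesis using r' m(3)[of p] that by auto
    qed
    have ra: "r \<le> a" using r' m(2) by auto
    have "shift r' m a (T((r, b) := T y, y := T (r, b))) = shift r ?m a T"
    proof
      fix u :: cell
      obtain p q where u: "u = (p, q)" by (cases u)
      have b': "b' \<le> m (Suc r')" using m(3)[of r'] m(1,2) by auto
      have mp: "m p \<le> m (Suc p)" if "r' \<le> p" "p \<le> a" using m(3) that by auto
      show "shift r' m a (T((r, b) := T y, y := T (r, b))) u = shift r ?m a T u"
        using r'
      proof
        assume "r' = r \<and> b' = Suc b"
        then show ?thesis
          using m(1,2) b' mp unfolding u yy shift_def
          by (cases "p = r"; cases "p = a") auto
      next
        assume "r' = Suc r \<and> b' = b"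
        then show ?thesis
          using m(1,2) b' mp unfolding u yy shift_def
          by (cases "p = r"; cases "p = Suc r"; cases "p = a") auto
      qed
    qed
    then have "slide (Suc f) lam T (r, b) = (shift r ?m a T, (a, ?m (Suc a)))"
      using sl m(5) ra unfolding yy by (simp del: slide.simps)
    then show ?case
      using mono ra m(4) by (intro Suc(2)[of ?m a]) (simp_all add: fun_upd_def del: slide.simps)
  qed
qed

text \<open>In a weakly decreasing list the parts that are at least \<open>j\<close> form an initial
  segment. This makes the row and column descriptions of the diagram agree.\<close>

lemma filter_sorted_desc:
  fixes xs :: "nat list"
  assumes "sorted_wrt (\<ge>) xs"
  shows "i < length (filter (\<lambda>p. j \<le> p) xs) \<longleftrightarrow> i < length xs \<and> j \<le> xs ! i"
  using assms
proof (induction xs arbitrary: i)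
  case (Cons x xs)
  show ?case
  proof (cases "j \<le> x")
    case True
    then show ?thesis using Cons by (cases i) auto
  next
    case False
    then have "filter (\<lambda>p. j \<le> p) xs = []" using Cons.prems by (auto simp: filter_empty_conv)
    moreover have "\<not> j \<le> (x # xs) ! i" if "i < length (x # xs)"
      using False Cons.prems that by (cases i) (auto dest!: nth_mem)
    ultimately show ?thesis using False by auto
  qed
qed simp

lemma upt_split: "i \<le> j \<Longrightarrow> j < l \<Longrightarrow> [i..<l] = [i..<j] @ j # [Suc j..<l]"
  using upt_add_eq_append[of i j "l - j"] by (simp add: upt_conv_Cons)

section \<open>Diagrams of partitions and a bound on slide lengths\<close>

locale young =
  fixes lam :: "nat list" and n :: nat
  assumes part: "is_partition lam n"
begin

abbreviation "D \<equiv> diagram lam"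

lemma D_iff_row: "(p, q) \<in> D \<longleftrightarrow> 1 \<le> p \<and> 1 \<le> q \<and> q \<le> rowlen lam p"
  by (auto simp: diagram_def)

lemma D_iff_col: "(p, q) \<in> D \<longleftrightarrow> 1 \<le> p \<and> 1 \<le> q \<and> p \<le> collen lam q"
proof (cases "1 \<le> p \<and> 1 \<le> q")
  case True
  have "sorted_wrt (\<ge>) lam" using part by (simp add: is_partition_def)
  from filter_sorted_desc[OF this, of "p - 1" q] True show ?thesis
    by (auto simp: D_iff_row rowlen_def collen_def)
qed (auto simp: D_iff_row)

lemma rowlen_antimono: "1 \<le> p' \<Longrightarrow> p' \<le> p \<Longrightarrow> rowlen lam p \<le> rowlen lam p'"
proof -
  assume p: "1 \<le> p'" "p' \<le> p"
  have "sorted_wrt (\<ge>) lam" using part by (simp add: is_partition_def)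
  then have "lam ! j \<le> lam ! i" if "i \<le> j" "j < length lam" for i j
    using that by (cases "i = j") (auto simp: sorted_wrt_iff_nth_less)
  then show ?thesis using p by (auto simp: rowlen_def)
qed

lemma D_down:
  assumes "(p, q) \<in> D" "1 \<le> p'" "p' \<le> p" "1 \<le> q'" "q' \<le> q"
  shows "(p', q') \<in> D"
  using assms rowlen_antimono[of p' p] by (auto simp: D_iff_row)

lemma D_pos: "(p, q) \<in> D \<Longrightarrow> 1 \<le> p \<and> 1 \<le> q"
  by (simp add: D_iff_row)

lemma finite_D: "finite D"
proof (rule finite_subset)
  show "D \<subseteq> {1..length lam} \<times> {1..rowlen lam 1}"
  proof
    fix u assume "u \<in> D"
    moreover obtain p q where "u = (p, q)" by (cases u)
    ultimately show "u \<in> {1..length lam} \<times> {1..rowlen lam 1}"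
      using rowlen_antimono[of 1 p] by (auto simp: D_iff_row rowlen_def split: if_splits)
  qed
qed simp

lemma card_D: "T \<in> tabloids lam \<Longrightarrow> card D = sum_list lam"
  by (auto simp: tabloids_def dest: bij_betw_same_card)

lemma arm_D: "int q \<le> int b + int (arm lam (p, b)) \<longleftrightarrow> (p, q) \<in> D"
  if "(p, b) \<in> D" "b \<le> q"
  using that by (auto simp: arm_def D_iff_row)

lemma leg_Suc: "int (leg lam (p, b)) = int (leg lam (Suc p, b)) + 1" if "(Suc p, b) \<in> D"
  using that by (auto simp: leg_def D_iff_col)

text \<open>Each exchange strictly lowers this number of cells weakly to the southeast, so it bounds
  the exchanges still possible. Hence the fuel \<open>sum_list lam\<close> never runs out
  early.\<close>

definition mu :: "cell \<Rightarrow> nat" where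
  "mu c = card {u \<in> D. fst c \<le> fst u \<and> snd c \<le> snd u}"

lemma mu_adj:
  assumes "c \<in> D" "adj c y"
  shows "mu y < mu c"
  unfolding mu_def
proof (rule psubset_card_mono)
  have "c \<in> {u \<in> D. fst c \<le> fst u \<and> snd c \<le> snd u}"
    "c \<notin> {u \<in> D. fst y \<le> fst u \<and> snd y \<le> snd u}"
    using assms by (auto simp: adj_def)
  then show "{u \<in> D. fst y \<le> fst u \<and> snd y \<le> snd u} \<subset> {u \<in> D. fst c \<le> fst u \<and> snd c \<le> snd u}"
    using assms by (auto simp: adj_def)
qed (simp add: finite_D)

lemma mu_pos: "c \<in> D \<Longrightarrow> 0 < mu c"
  unfolding mu_def card_gt_0_iff using finite_D by (cases c) auto

lemma mu_le: "T \<in> tabloids lam \<Longrightarrow> mu c \<le> sum_list lam"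
  unfolding mu_def card_D[symmetric] by (rule card_mono) (auto simp: finite_D)

section \<open>Partially sorted fillings\<close>

text \<open>The final segment of the cell order that begins at \<open>(r, b)\<close>. For
  \<open>r\<close> one beyond the column length it is the part to the right of column
  \<open>b\<close>.\<close>

definition reg :: "nat \<Rightarrow> nat \<Rightarrow> cell set" where
  "reg r b = {(p, q). (p, q) \<in> D \<and> (b < q \<or> q = b \<and> r \<le> p)}"

lemma reg_iff [simp]: "(p, q) \<in> reg r b \<longleftrightarrow> (p, q) \<in> D \<and> (b < q \<or> q = b \<and> r \<le> p)"
  by (simp add: reg_def)

lemma reg_adj: "u \<in> reg r b \<Longrightarrow> adj u v \<Longrightarrow> v \<in> D \<Longrightarrow> v \<in> reg r b"
  by (cases u, cases v) auto

lemma reg_D: "u \<in> reg r b \<Longrightarrow> u \<in> D"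
  by (cases u) auto

definition srt :: "nat \<Rightarrow> nat \<Rightarrow> (cell \<Rightarrow> nat) \<Rightarrow> bool" where
  "srt r b T \<longleftrightarrow> (\<forall>u v. u \<in> reg r b \<longrightarrow> adj u v \<longrightarrow> v \<in> D \<longrightarrow> T u < T v)"

text \<open>Sortedness away from the cell \<open>c\<close> of the moving entry, which may only be too large.\<close>
definition asrt :: "nat \<Rightarrow> nat \<Rightarrow> (cell \<Rightarrow> nat) \<Rightarrow> cell \<Rightarrow> bool" where
  "asrt r b T c \<longleftrightarrow> c \<in> reg r b
     \<and> (\<forall>u v. u \<in> reg r b \<longrightarrow> adj u v \<longrightarrow> v \<in> D \<longrightarrow> u \<noteq> c \<longrightarrow> T u < T v)
     \<and> (\<forall>u w. u \<in> reg r b \<longrightarrow> adj u c \<longrightarrow> adj c w \<longrightarrow> w \<in> D \<longrightarrow> T u < T w)"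

lemma asrtD:
  assumes "asrt r b T c"
  shows "c \<in> reg r b" "c \<in> D"
    and "\<And>u v. u \<in> reg r b \<Longrightarrow> adj u v \<Longrightarrow> v \<in> D \<Longrightarrow> u \<noteq> c \<Longrightarrow> T u < T v"
    and "\<And>u w. u \<in> reg r b \<Longrightarrow> adj u c \<Longrightarrow> adj c w \<Longrightarrow> w \<in> D \<Longrightarrow> T u < T w"
  using assms reg_D unfolding asrt_def by blast+

lemma asrt_start: "(r, b) \<in> D \<Longrightarrow> asrt r b T (r, b) \<longleftrightarrow> srt (Suc r) b T"
proof
  assume "(r, b) \<in> D" "asrt r b T (r, b)"
  moreover have "u \<in> reg r b \<and> u \<noteq> (r, b)" if "u \<in> reg (Suc r) b" for u
    using that by (cases u) auto
  ultimately show "srt (Suc r) b T" unfolding asrt_def srt_def by blast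
next
  assume r: "(r, b) \<in> D" "srt (Suc r) b T"
  moreover have "u \<in> reg (Suc r) b" if "u \<in> reg r b" "u \<noteq> (r, b)" for u
    using that by (cases u) auto
  moreover have "\<not> adj u (r, b)" if "u \<in> reg r b" for u
    using that by (cases u) auto
  ultimately show "asrt r b T (r, b)" unfolding asrt_def srt_def by auto
qed

lemma srt_asrt: "srt r b T \<Longrightarrow> c \<in> reg r b \<Longrightarrow> asrt r b T c"
  unfolding srt_def asrt_def by (meson less_trans reg_D)

lemma asrt_stop:
  assumes "asrt r b T c" "T \<in> tabloids lam"
    and "\<And>v. adj c v \<Longrightarrow> v \<in> D \<Longrightarrow> T c \<le> T v"
  shows "srt r b T"
  unfolding srt_def
proof (intro allI impI)
  fix u v assume uv: "u \<in> reg r b" "adj u v" "v \<in> D"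
  show "T u < T v"
  proof (cases "u = c")
    case True
    have "T u \<noteq> T v"
      using inj_onD[OF tabloid_inj[OF assms(2)]] uv adj_neq reg_D by blast
    then show ?thesis using assms(3) True uv by (simp add: le_neq_implies_less)
  next
    case False
    then show ?thesis using asrtD(3)[OF assms(1)] uv by simp
  qed
qed

text \<open>The entry that replaces the moving one at \<open>c\<close> exceeds the predecessors of
  \<open>c\<close> by the last clause of \<open>asrt\<close>, and is below the other successor of
  \<open>c\<close> by minimality of \<open>T y\<close>.\<close>

lemma asrt_move:
  assumes as: "asrt r b T c" and T: "T \<in> tabloids lam"
    and y: "adj c y" "y \<in> D" "T y < T c" "\<And>v. adj c v \<Longrightarrow> v \<in> D \<Longrightarrow> T y \<le> T v"
  shows "asrt r b (T(c := T y, y := T c)) y"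
proof -
  note c = asrtD(1)[OF as] and as1 = asrtD(3)[OF as] and as2 = asrtD(4)[OF as]
  have cy: "c \<noteq> y" using y(1) adj_neq by blast
  have y4: "T y < T v" if "adj c v" "v \<in> D" "v \<noteq> y" for v
  proof -
    have "T y \<noteq> T v" using inj_onD[OF tabloid_inj[OF T]] that y by blast
    then show ?thesis using y(4) that by (simp add: le_neq_implies_less)
  qed
  have yr: "y \<in> reg r b" using reg_adj c y by blast
  have "(T(c := T y, y := T c)) u < (T(c := T y, y := T c)) v"
    if "u \<in> reg r b" "adj u v" "v \<in> D" "u \<noteq> y" for u v
  proof (cases "u = c")
    case True
    have "v \<noteq> c" using adj_neq that True by blast
    then show ?thesis using True that y(3) y4[of v] cy by (cases "v = y") auto
  next
    case False
    note uc = this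
    show ?thesis
    proof (cases "v = c")
      case True
      then show ?thesis using as2[of u y] uc that y(1,2) cy by auto
    next
      case False
      then show ?thesis using as1[of u v] uc that y(3) by auto
    qed
  qed
  moreover have "(T(c := T y, y := T c)) u < (T(c := T y, y := T c)) w"
    if "u \<in> reg r b" "adj u y" "adj y w" "w \<in> D" for u w
  proof -
    have wc: "w \<noteq> c" "w \<noteq> y" "u \<noteq> y" using that y(1) adj_asym adj_neq by blast+
    have yw: "T y < T w" using as1[of y w] yr that cy by blast
    show ?thesis
    proof (cases "u = c")
      case True
      then show ?thesis using yw wc by auto
    next
      case False
      then show ?thesis using as1[of u y] yw wc that y(2) by auto
    qed
  qed
  ultimately show ?thesis using yr unfolding asrt_def by blast
qed

lemma slide_srt:
  assumes "asrt r b T c" "T \<in> tabloids lam" "mu c \<le> f"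
  shows "srt r b (fst (slide f lam T c))"
  using assms
proof (induction f arbitrary: T c)
  case 0
  then show ?case using mu_pos[OF asrtD(2)] by fastforce
next
  case (Suc f)
  have c: "c \<in> D" using Suc.prems asrtD(2) by blast
  show ?case
  proof (rule slide_cases[of f lam T c])
    assume "slide (Suc f) lam T c = (T, c)" "\<And>v. adj c v \<Longrightarrow> v \<in> D \<Longrightarrow> T c \<le> T v"
    then show ?thesis using asrt_stop Suc.prems by auto
  next
    fix y assume y: "adj c y" "y \<in> D" "T y < T c" "\<And>v. adj c v \<Longrightarrow> v \<in> D \<Longrightarrow> T y \<le> T v"
      and sl: "slide (Suc f) lam T c = slide f lam (T(c := T y, y := T c)) y"
    show ?thesis
      unfolding sl
    proof (rule Suc.IH)
      show "mu y \<le> f" using mu_adj[OF c y(1)] Suc.prems(3) by simp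
    qed (intro asrt_move tabloid_swap Suc.prems c y; assumption)+
  qed
qed

text \<open>Undoing one exchange: the moving entry returns from \<open>c\<close> to the larger one \<open>w\<close> of its
  predecessors.\<close>
lemma asrt_back:
  assumes as: "asrt r b T c" and w: "w \<in> reg r b" "adj w c"
    and large: "\<And>u. u \<in> reg r b \<Longrightarrow> adj u c \<Longrightarrow> u \<noteq> w \<Longrightarrow> T u < T w"
  shows "asrt r b (T(c := T w, w := T c)) w"
    and "slide (Suc f) lam (T(c := T w, w := T c)) w = slide f lam T c"
proof -
  note c = asrtD(1)[OF as] and as1 = asrtD(3)[OF as] and as2 = asrtD(4)[OF as]
  have cD: "c \<in> D" "w \<in> D" using c w reg_D by auto
  have cw: "c \<noteq> w" using w(2) adj_neq by blast
  have wc: "T w < T c" using as1[of w c] w cw cD by auto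
  let ?T = "T(c := T w, w := T c)"
  have "?T u < ?T v" if "u \<in> reg r b" "adj u v" "v \<in> D" "u \<noteq> w" for u v
  proof (cases "u = c")
    case True
    then have "v \<noteq> w" "v \<noteq> c" using that w adj_asym adj_neq by blast+
    then show ?thesis using True as2[of w v] w that cw by auto
  next
    case False
    note uc = this
    have uv: "T u < T v" using as1 that uc by auto
    show ?thesis
    proof (cases "v = c")
      case True
      then show ?thesis using large[of u] that uc cw by auto
    next
      case False
      then show ?thesis using uv uc that wc by auto
    qed
  qed
  moreover have "?T u < ?T v" if "u \<in> reg r b" "adj u w" "adj w v" "v \<in> D" for u v
  proof -
    have ne: "u \<noteq> c" "u \<noteq> w" "v \<noteq> w" using that w adj_asym adj_neq by blast+
    have uw: "T u < T w" using as1[of u w] that ne cD by auto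
    show ?thesis
    proof (cases "v = c")
      case True
      then show ?thesis using uw ne by auto
    next
      case False
      have "T w < T v" using as1[of w v] w that cw by auto
      then show ?thesis using False uw ne by auto
    qed
  qed
  ultimately show "asrt r b ?T w" using w unfolding asrt_def by blast
  have "slide (Suc f) lam ?T w = slide f lam (?T(w := ?T c, c := ?T w)) c"
  proof (rule slide_moveI)
    fix v assume v: "adj w v" "v \<in> D" "v \<noteq> c"
    have "v \<noteq> w" using adj_neq[OF v(1)] by simp
    then show "?T c < ?T v" using as1[of w v] v w cw by auto
  qed (use w cD wc cw in auto)
  moreover have "?T(w := ?T c, c := ?T w) = T" using cw by auto
  ultimately show "slide (Suc f) lam ?T w = slide f lam T c" by simp
qed

end

section \<open>Reverse paths\<close>

text \<open>A reverse path steps from a cell to the larger one of its upper and left neighbours, staying in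
  the columns from \<open>b\<close> on. If it enters row \<open>p\<close> in column \<open>q\<close>, it leaves that row upwards
  in column \<open>exit_col T b p q\<close>; and \<open>entry_col T b i q p\<close> is the column in which the reverse path
  from \<open>(i, q)\<close> enters row \<open>p\<close>.\<close>
definition exit_col :: "(cell \<Rightarrow> nat) \<Rightarrow> nat \<Rightarrow> nat \<Rightarrow> nat \<Rightarrow> nat" where
  "exit_col T b p q = Max {y. b \<le> y \<and> y \<le> q \<and> (y = b \<or> T (p, y - 1) < T (p - 1, y))}"

function entry_col :: "(cell \<Rightarrow> nat) \<Rightarrow> nat \<Rightarrow> nat \<Rightarrow> nat \<Rightarrow> nat \<Rightarrow> nat" where
  "entry_col T b i q p = (if p < i then exit_col T b (Suc p) (entry_col T b i q (Suc p)) else q)"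
  by auto
termination by (relation "measure (\<lambda>(T, b, i, q, p). i - p)") auto

declare entry_col.simps [simp del]

lemma exit_col_finite: "finite {y. b \<le> y \<and> y \<le> q \<and> P y}" for b q :: nat
  by (rule finite_subset[of _ "{b..q}"]) auto

lemma exit_col_props:
  assumes "b \<le> q"
  shows "b \<le> exit_col T b p q" "exit_col T b p q \<le> q"
    "exit_col T b p q = b \<or> T (p, exit_col T b p q - 1) < T (p - 1, exit_col T b p q)"
proof -
  have "exit_col T b p q \<in> {y. b \<le> y \<and> y \<le> q \<and> (y = b \<or> T (p, y - 1) < T (p - 1, y))}"
    unfolding exit_col_def by (rule Max_in) (use assms exit_col_finite in auto)
  then show "b \<le> exit_col T b p q" "exit_col T b p q \<le> q"
    "exit_col T b p q = b \<or> T (p, exit_col T b p q - 1) < T (p - 1, exit_col T b p q)" by auto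
qed

lemma exit_col_ge:
  assumes "b \<le> y" "y \<le> q" "T (p, y - 1) < T (p - 1, y)"
  shows "y \<le> exit_col T b p q"
  unfolding exit_col_def by (rule Max_ge) (use assms exit_col_finite in auto)

lemma exit_col_le_iff:
  assumes "b \<le> q" "b \<le> m"
  shows "exit_col T b p q \<le> m \<longleftrightarrow> (\<forall>y. m < y \<and> y \<le> q \<longrightarrow> \<not> T (p, y - 1) < T (p - 1, y))"
proof
  assume "exit_col T b p q \<le> m"
  then show "\<forall>y. m < y \<and> y \<le> q \<longrightarrow> \<not> T (p, y - 1) < T (p - 1, y)"
    using exit_col_ge[of b _ q T p] assms by (meson le_less_trans less_le_not_le order.strict_implies_order)
next
  assume "\<forall>y. m < y \<and> y \<le> q \<longrightarrow> \<not> T (p, y - 1) < T (p - 1, y)"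
  then show "exit_col T b p q \<le> m"
    using exit_col_props[OF assms(1), of T p] assms by (metis not_less)
qed

text \<open>Whether a column is an exit does not depend on where the row was entered, so entering
  further right only enlarges the set of exits. This is what keeps reverse paths from
  crossing.\<close>

lemma exit_col_mono:
  assumes "b \<le> q" "q \<le> q'"
  shows "exit_col T b p q \<le> exit_col T b p q'"
  using exit_col_props[OF assms(1), of T p] exit_col_props[of b q' T p] exit_col_ge[of b _ q' T p] assms
  by (metis le_trans)

lemma exit_col_cong:
  assumes "b \<le> q" "\<And>y. b < y \<Longrightarrow> y \<le> q \<Longrightarrow> T (p, y - 1) = S (p, y - 1)"
    "\<And>y. b < y \<Longrightarrow> y \<le> q \<Longrightarrow> T (p - 1, y) = S (p - 1, y)"
  shows "exit_col T b p q = exit_col S b p q"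
proof -
  have "{y. b \<le> y \<and> y \<le> q \<and> (y = b \<or> T (p, y - 1) < T (p - 1, y))}
      = {y. b \<le> y \<and> y \<le> q \<and> (y = b \<or> S (p, y - 1) < S (p - 1, y))}"
    using assms by (auto simp: le_less)
  then show ?thesis by (simp add: exit_col_def)
qed

lemma entry_col_self [simp]: "entry_col T b i q i = q"
  by (simp add: entry_col.simps)

lemma entry_col_step:
  "p < i \<Longrightarrow> entry_col T b i q p = exit_col T b (Suc p) (entry_col T b i q (Suc p))"
  by (subst entry_col.simps) simp

lemma entry_col_bounds:
  assumes "b \<le> q" "p \<le> i"
  shows "b \<le> entry_col T b i q p \<and> entry_col T b i q p \<le> q"
  using assms(2)
proof (induction p rule: inc_induct)
  case base
  then show ?case using assms(1) by simp
next
  case (step p)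
  then show ?case
    using exit_col_props(1,2)[of b "entry_col T b i q (Suc p)" T "Suc p"]
    by (auto simp: entry_col_step)
qed

text \<open>Reverse paths do not cross.\<close>
lemma entry_col_mono:
  assumes "b \<le> q" "b \<le> q'" "p' \<le> i" "p' \<le> i'" "p \<le> p'"
    and "entry_col T b i q p' \<le> entry_col T b i' q' p'"
  shows "entry_col T b i q p \<le> entry_col T b i' q' p"
  using assms(5)
proof (induction p rule: inc_induct)
  case base
  then show ?case using assms by simp
next
  case (step p)
  then show ?case
    using assms(3,4) entry_col_bounds[OF assms(1), of "Suc p" i T]
    by (auto simp: entry_col_step intro: exit_col_mono)
qed

lemma entry_col_at_b:
  assumes "p \<le> i"
  shows "entry_col T b i b p = b"
  using entry_col_bounds[of b b p i T] assms by simp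

lemma entry_col_cong:
  assumes "b \<le> q" "p \<le> i"
    and "\<And>p' y. p \<le> p' \<Longrightarrow> p' \<le> i \<Longrightarrow> b \<le> y \<Longrightarrow> T (p', y) = S (p', y)"
  shows "entry_col T b i q p = entry_col S b i q p"
  using assms(2)
proof (induction p rule: inc_induct)
  case base
  then show ?case by simp
next
  case (step p)
  have "exit_col T b (Suc p) (entry_col S b i q (Suc p)) = exit_col S b (Suc p) (entry_col S b i q (Suc p))"
    by (rule exit_col_cong) (use step assms entry_col_bounds[OF assms(1), of "Suc p" i S] in auto)
  then show ?case using step by (simp add: entry_col_step)
qed

text \<open>Among the cells \<open>(i, h i)\<close> with \<open>i\<close> in \<open>I\<close>, the cell in row \<open>e\<close> is dominant if its
  reverse path runs weakly to the right of the others.\<close>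
definition dominant :: "(cell \<Rightarrow> nat) \<Rightarrow> nat \<Rightarrow> nat set \<Rightarrow> (nat \<Rightarrow> nat) \<Rightarrow> nat \<Rightarrow> bool" where
  "dominant T b I h e \<longleftrightarrow> e \<in> I \<and> (\<forall>i\<in>I. (i < e \<longrightarrow> h i < entry_col T b e (h e) i) \<and>
     (e < i \<longrightarrow> entry_col T b i (h i) e \<le> h e))"

text \<open>For two rows the strict and the weak inequality are complementary: a tie, where the path
  of the lower cell enters the upper row exactly at the upper cell, goes to the upper row.\<close>

lemma dominant_unique:
  assumes "dominant T b I h e" "dominant T b I h e'"
  shows "e = e'"
  using assms unfolding dominant_def by (metis linorder_less_linear not_less)

text \<open>Rows are added from the bottom upwards. A new cell strictly left of the dominant path
  changes nothing; otherwise it becomes dominant itself, since by non-crossing all other paths enter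
  its row weakly left of the old dominant one.\<close>

lemma dominant_exists:
  assumes fin: "finite I" "I \<noteq> {}" and b: "\<And>i. i \<in> I \<Longrightarrow> b \<le> h i"
  obtains e where "dominant T b I h e"
proof -
  define N where "N = Suc (Max I)"
  have main: "I \<inter> {s..} = {} \<or> (\<exists>e. dominant T b (I \<inter> {s..}) h e)" if "s \<le> N" for s
    using that
  proof (induction s rule: inc_induct)
    case base
    have "i < N" if "i \<in> I" for i using fin that by (simp add: N_def less_Suc_eq_le)
    then have "I \<inter> {N..} = {}" by fastforce
    then show ?case by blast
  next
    case (step s)
    have split: "I \<inter> {s..} = (if s \<in> I then insert s (I \<inter> {Suc s..}) else I \<inter> {Suc s..})"
      by (auto simp: Suc_le_eq le_less)
    show ?case
    proof (cases "s \<in> I")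
      case False
      then show ?thesis using step.IH split by simp
    next
      case sI: True
      show ?thesis
      proof (cases "I \<inter> {Suc s..} = {}")
        case True
        then have "I \<inter> {s..} = {s}" using split sI by simp
        then show ?thesis by (auto simp: dominant_def)
      next
        case False
        then obtain e where e: "dominant T b (I \<inter> {Suc s..}) h e" using step.IH by blast
        then have eI: "e \<in> I" "s < e" by (auto simp: dominant_def)
        show ?thesis
        proof (cases "h s < entry_col T b e (h e) s")
          case True
          then have "dominant T b (I \<inter> {s..}) h e"
            using e eI split sI by (auto simp: dominant_def)
          then show ?thesis by blast
        next
          case False
          have "entry_col T b i (h i) s \<le> h s" if i: "i \<in> I" "s < i" for i
          proof -
            have "entry_col T b i (h i) s \<le> entry_col T b e (h e) s"
            proof (cases i e rule: linorder_cases)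
              case less
              then have "h i < entry_col T b e (h e) i" using e i by (auto simp: dominant_def)
              then show ?thesis
                using less i eI b by - (rule entry_col_mono[of _ _ _ i], auto)
            next
              case greater
              then have "entry_col T b i (h i) e \<le> h e" using e i by (auto simp: dominant_def)
              then show ?thesis
                using greater i eI b by - (rule entry_col_mono[of _ _ _ e], auto)
            qed simp
            then show ?thesis using False by simp
          qed
          then have "dominant T b (I \<inter> {s..}) h s"
            using sI by (auto simp: dominant_def)
          then show ?thesis by blast
        qed
      qed
    qed
  qed
  have "I \<inter> {0..} = I" by auto
  then show thesis using main[of 0] fin that by auto
qed

section \<open>One slide path and the reverse paths on its two sides\<close>

text \<open>\<open>T\<close> and \<open>S\<close> are the fillings before and after the slide at
  \<open>(r, b)\<close>; \<open>m\<close> and \<open>a\<close> encode its path as in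
  \<open>shift\<close>. The inequalities below come from reading an entry on the path in both
  fillings.\<close>

locale slid = young +
  fixes r b a :: nat and m :: "nat \<Rightarrow> nat" and T S :: "cell \<Rightarrow> nat"
  assumes T: "T \<in> tabloids lam" and S: "S \<in> tabloids lam"
    and srtT: "srt (Suc r) b T" and srtS: "srt r b S"
    and start: "(r, b) \<in> D" "m r = b" "r \<le> a"
    and mono: "\<And>p. r \<le> p \<Longrightarrow> p \<le> a \<Longrightarrow> m p \<le> m (Suc p)"
    and final: "(a, m (Suc a)) \<in> D"
    and S_eq: "S = shift r m a T"
begin

lemma m_mono:
  assumes "r \<le> p" "p \<le> p'" "p' \<le> Suc a"
  shows "m p \<le> m p'"
  using assms(2,3)
proof (induction p' rule: dec_induct)
  case (step k)
  then show ?case using mono[of k] assms(1) by auto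
qed simp

lemma m_ge: "r \<le> p \<Longrightarrow> p \<le> Suc a \<Longrightarrow> b \<le> m p"
  using m_mono[of r p] start by simp

lemma path_D: "r \<le> p \<Longrightarrow> p \<le> a \<Longrightarrow> m p \<le> q \<Longrightarrow> q \<le> m (Suc p) \<Longrightarrow> (p, q) \<in> D"
  using D_down[OF final, of p q] m_mono[of "Suc p" "Suc a"] m_ge[of p] D_pos[OF start(1)] by auto

lemma S_right: "r \<le> p \<Longrightarrow> p \<le> a \<Longrightarrow> m p \<le> q \<Longrightarrow> q < m (Suc p) \<Longrightarrow> S (p, q) = T (p, Suc q)"
  by (simp add: S_eq shift_def)

lemma S_down: "r \<le> p \<Longrightarrow> p < a \<Longrightarrow> S (p, m (Suc p)) = T (Suc p, m (Suc p))"
  by (simp add: S_eq shift_def)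

lemma S_final: "S (a, m (Suc a)) = T (r, b)"
  using start by (simp add: S_eq shift_def)

lemma S_off:
  "\<not> (r \<le> p \<and> p \<le> a \<and> m p \<le> q \<and> q \<le> m (Suc p)) \<Longrightarrow> S (p, q) = T (p, q)"
  using start mono[of a] mono[of p] by (auto simp: S_eq shift_def)

lemma T_right: "(p, q) \<in> reg (Suc r) b \<Longrightarrow> (p, Suc q) \<in> D \<Longrightarrow> T (p, q) < T (p, Suc q)"
  and T_down: "(p, q) \<in> reg (Suc r) b \<Longrightarrow> (Suc p, q) \<in> D \<Longrightarrow> T (p, q) < T (Suc p, q)"
  and S_incr_right: "(p, q) \<in> reg r b \<Longrightarrow> (p, Suc q) \<in> D \<Longrightarrow> S (p, q) < S (p, Suc q)"
  and S_incr_down: "(p, q) \<in> reg r b \<Longrightarrow> (Suc p, q) \<in> D \<Longrightarrow> S (p, q) < S (Suc p, q)"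
  using srtT srtS unfolding srt_def by (simp_all del: reg_iff)

lemma T_out: "u \<notin> D \<Longrightarrow> T u = 0"
  using T by (cases u) (simp add: tabloids_def)

text \<open>The slide path is the reverse path of its final cell.\<close>
lemma exit_col_path:
  assumes "r \<le> p" "p \<le> a"
  shows "exit_col S b p (m (Suc p)) = m p"
proof (rule antisym)
  have mp: "b \<le> m p" "m p \<le> m (Suc p)" using m_ge[of p] mono[of p] assms by auto
  \<comment> \<open>The entry left of \<open>(p, y)\<close> came from \<open>(p, y)\<close> itself,
    so the comparison becomes one within a column of \<open>T\<close>. In row 1 the upper value is
    the default 0.\<close>
  have "\<not> S (p, y - 1) < S (p - 1, y)" if y: "m p < y" "y \<le> m (Suc p)" for y
  proof -
    have 1: "S (p, y - 1) = T (p, y)" using S_right[of p "y - 1"] y assms by simp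
    have 2: "S (p - 1, y) = T (p - 1, y)"
      by (rule S_off) (use y assms D_pos[OF start(1)] in auto)
    have yD: "(p, y) \<in> D" using path_D[of p y] y assms by simp
    show ?thesis
    proof (cases "(p - 1, y) \<in> D")
      case True
      have "1 \<le> p" using D_pos[OF yD] by simp
      then show ?thesis
        using T_down[of "p - 1" y] True yD y mp unfolding 1 2 by simp
    next
      case False
      then show ?thesis using T_out 2 by simp
    qed
  qed
  then show "exit_col S b p (m (Suc p)) \<le> m p"
    using mp by (subst exit_col_le_iff) auto
  show "m p \<le> exit_col S b p (m (Suc p))"
  proof (cases "m p = b")
    case True
    then show ?thesis using exit_col_props(1) mp by simp
  next
    case False
    then have p: "r < p" using start assms by (cases "p = r") auto
    \<comment> \<open>Where the path came from above, the upper neighbour holds the entry that moved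
      up from \<open>(p, m p)\<close>; in \<open>T\<close> it exceeds the entry on its left.\<close>
    have 1: "S (p - 1, m p) = T (p, m p)" using S_down[of "p - 1"] p assms by simp
    have 2: "S (p, m p - 1) = T (p, m p - 1)"
      by (rule S_off) (use False mp in auto)
    have mD: "(p, m p) \<in> D" using path_D[of p "m p"] mp assms by simp
    have "(p, m p - 1) \<in> reg (Suc r) b"
      using D_down[OF mD, of p "m p - 1"] D_pos[OF mD] D_pos[OF start(1)] False mp p by auto
    then have "T (p, m p - 1) < T (p, m p)"
      using T_right[of p "m p - 1"] mD False mp by (simp del: reg_iff)
    then show ?thesis
      using mp unfolding 1[symmetric] 2[symmetric] by (intro exit_col_ge)
  qed
qed

lemma entry_col_path:
  assumes "r \<le> Suc p" "p \<le> a"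
  shows "entry_col S b a (m (Suc a)) p = m (Suc p)"
  using assms(2,1)
proof (induction p rule: inc_induct)
  case (step p)
  then show ?case using exit_col_path[of "Suc p"] by (simp add: entry_col_step)
qed simp

lemma entry_col_path_end: "entry_col S b a (m (Suc a)) (r - 1) = b"
  using entry_col_path[of "r - 1"] start D_pos[OF start(1)] by simp

text \<open>In \<open>T\<close>, no reverse path changes sides of the slide path.\<close>
lemma exit_col_side:
  assumes "r \<le> p" "p < a" "b \<le> q" "(Suc p, q) \<in> D"
  shows "exit_col T b (Suc p) q \<le> m p \<longleftrightarrow> q \<le> m (Suc p)"
proof
  assume q: "q \<le> m (Suc p)"
  \<comment> \<open>In these columns \<open>T (p, y)\<close> becomes \<open>S (p, y - 1)\<close>,
    while the cell below that one is off the path. The column order of \<open>S\<close> forbids an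
    exit.\<close>
  have "\<not> T (Suc p, y - 1) < T (p, y)" if y: "m p < y" "y \<le> q" for y
  proof -
    have 1: "S (p, y - 1) = T (p, y)" using S_right[of p "y - 1"] y assms q by simp
    have 2: "S (Suc p, y - 1) = T (Suc p, y - 1)"
      by (rule S_off) (use y q in auto)
    have 3: "(Suc p, y - 1) \<in> D"
      using D_down[OF assms(4), of "Suc p" "y - 1"] y m_ge[of p] D_pos[OF start(1)] assms by auto
    have 4: "(p, y - 1) \<in> reg r b"
      using D_down[OF 3, of p "y - 1"] y m_ge[of p] D_pos[OF start(1)] assms by auto
    show ?thesis using S_incr_down[OF 4 3] unfolding 1 2 by simp
  qed
  then show "exit_col T b (Suc p) q \<le> m p"
    using assms m_ge[of p] by (subst exit_col_le_iff) auto
next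
  assume ex: "exit_col T b (Suc p) q \<le> m p"
  show "q \<le> m (Suc p)"
  proof (rule ccontr)
    let ?y = "m (Suc p)"
    assume "\<not> q \<le> m (Suc p)"
    then have q: "?y < q" by simp
    \<comment> \<open>The column just right of the vertical step is an exit: the entry moved up
      through the step stands in \<open>S\<close> directly left of \<open>T (p, Suc ?y)\<close>, and
      rows of \<open>S\<close> increase.\<close>
    have 1: "S (p, ?y) = T (Suc p, ?y)" using S_down assms by simp
    have 2: "S (p, Suc ?y) = T (p, Suc ?y)" by (rule S_off) auto
    have yb: "b \<le> ?y" using m_ge[of "Suc p"] assms by simp
    have D1: "(p, Suc ?y) \<in> D" "(p, ?y) \<in> D"
      using D_down[OF assms(4), of p] q yb D_pos[OF start(1)] assms by auto
    then have "T (Suc p, ?y) < T (p, Suc ?y)"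
      using S_incr_right[of p ?y] yb assms unfolding 1 2 by (auto simp: le_less)
    then have "Suc ?y \<le> exit_col T b (Suc p) q"
      using yb q by (intro exit_col_ge) auto
    then show False using ex mono[of p] assms by simp
  qed
qed

lemma entry_D:
  assumes "(i, q) \<in> D" "b \<le> q" "1 \<le> p" "p \<le> i"
  shows "(p, entry_col R b i q p) \<in> D"
  using entry_col_bounds[OF assms(2,4), of R] D_down[OF assms(1,3,4)] D_pos[OF start(1)] by auto

text \<open>Iterates \<open>exit_col_side\<close> from row \<open>p\<close> up to row
  \<open>r\<close>, where \<open>m r = b\<close> and no reverse path gets left of
  \<open>b\<close>.\<close>

lemma entry_side:
  assumes "r \<le> p" "p \<le> a" "p \<le> i" "(i, q) \<in> D" "b \<le> q"
  shows "entry_col T b i q r = b \<longleftrightarrow> entry_col T b i q p \<le> m p"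
  using assms(1-3)
proof (induction p rule: dec_induct)
  case base
  have "b \<le> entry_col T b i q r" using entry_col_bounds[of b q r i T] base assms by simp
  then show ?case using start by auto
next
  case (step p)
  have "entry_col T b i q p = exit_col T b (Suc p) (entry_col T b i q (Suc p))"
    using step by (simp add: entry_col_step)
  then show ?case
    using step exit_col_side[of p "entry_col T b i q (Suc p)"] entry_D[of i q "Suc p" T]
      entry_col_bounds[of b q "Suc p" i T] assms by simp
qed

lemma entry_side_above:
  assumes "r \<le> i" "i \<le> a" "(i, q) \<in> D" "b \<le> q"
  shows "entry_col T b i q r = b \<longleftrightarrow> q \<le> m i"
  using entry_side[of i i q] assms by simp

text \<open>Below row \<open>a\<close> the fillings agree, so both paths enter row
  \<open>Suc a\<close> in the same column. In \<open>T\<close> there are no exits in the columns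
  from \<open>m a + 1\<close> to \<open>m (Suc a)\<close>, and further right the exits of
  \<open>T\<close> and \<open>S\<close> coincide; hence the threshold \<open>m a\<close> for
  \<open>T\<close> turns into \<open>m (Suc a)\<close> for \<open>S\<close>.\<close>

lemma entry_side_below:
  assumes "a < i" "(i, q) \<in> D" "b \<le> q"
  shows "entry_col T b i q r = b \<longleftrightarrow> entry_col S b i q a \<le> m (Suc a)"
proof -
  define x where "x = entry_col S b i q (Suc a)"
  have eq: "entry_col T b i q (Suc a) = x"
    unfolding x_def by (rule entry_col_cong) (use assms S_off in auto)
  have x: "b \<le> x" "(Suc a, x) \<in> D"
    using entry_col_bounds[of b q "Suc a" i S] entry_D[of i q "Suc a" S] assms by (auto simp: x_def)
  have ma: "b \<le> m a" "m a \<le> m (Suc a)" using m_ge[of a] mono[of a] start by auto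
  have off: "S (Suc a, y) = T (Suc a, y)" for y by (rule S_off) simp
  have off': "S (a, y) = T (a, y)" if "m (Suc a) < y" for y by (rule S_off) (use that in simp)
  have path: "\<not> T (Suc a, y - 1) < T (a, y)" if y: "m a < y" "y \<le> m (Suc a)" "y \<le> x" for y
  proof -
    have 1: "S (a, y - 1) = T (a, y)" using S_right[of a "y - 1"] y start by simp
    have 3: "(Suc a, y - 1) \<in> D"
      using D_down[OF x(2), of "Suc a" "y - 1"] y ma D_pos[OF start(1)] by auto
    have 4: "(a, y - 1) \<in> reg r b"
      using D_down[OF 3, of a "y - 1"] y ma D_pos[OF start(1)] start(3) by auto
    show ?thesis using S_incr_down[OF 4 3] unfolding 1 off by simp
  qed
  have "exit_col T b (Suc a) x \<le> m a \<longleftrightarrow> exit_col S b (Suc a) x \<le> m (Suc a)"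
    using x ma path off' by (auto simp: exit_col_le_iff off) (metis not_less)+
  then show ?thesis
    using entry_side[of a i q] assms start eq by (simp add: entry_col_step x_def)
qed

end

text \<open>Every other reverse path is squeezed between column \<open>b\<close> and the dominant
  path.\<close>

lemma dominant_reach:
  assumes "dominant T b I h e" "entry_col T b e (h e) p = b" "i \<in> I"
    and "\<And>i. i \<in> I \<Longrightarrow> p \<le> i \<and> b \<le> h i"
  shows "entry_col T b i (h i) p = b"
proof -
  have e: "e \<in> I" using assms(1) by (simp add: dominant_def)
  have "entry_col T b i (h i) p \<le> entry_col T b e (h e) p"
  proof (cases i e rule: linorder_cases)
    case less
    then show ?thesis
      using assms(1,3) assms(4)[OF assms(3)] assms(4)[OF e]
      by - (rule entry_col_mono[of _ _ _ i], auto simp: dominant_def le_less)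
  next
    case greater
    then show ?thesis
      using assms(1,3) assms(4)[OF assms(3)] assms(4)[OF e]
      by - (rule entry_col_mono[of _ _ _ e], auto simp: dominant_def)
  qed simp
  then show ?thesis
    using assms(2) entry_col_bounds[of b "h i" p i T] assms(4)[OF assms(3)] by simp
qed

section \<open>One step of the algorithm is bijective\<close>

definition hook_shift :: "nat \<Rightarrow> nat \<Rightarrow> nat \<Rightarrow> nat \<Rightarrow> (cell \<Rightarrow> int) \<Rightarrow> cell \<Rightarrow> int" where
  "hook_shift r b a c H = (\<lambda>(p, q). if q = b \<and> r \<le> p \<and> p < a then H (Suc p, b) - 1
     else if (p, q) = (a, b) then int c - int b else H (p, q))"

definition hook_unshift :: "nat \<Rightarrow> nat \<Rightarrow> nat \<Rightarrow> (cell \<Rightarrow> int) \<Rightarrow> cell \<Rightarrow> int" where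
  "hook_unshift r b a H = (\<lambda>(p, q). if q = b \<and> r < p \<and> p \<le> a then H (p - 1, b) + 1
     else if (p, q) = (r, b) then 0 else H (p, q))"

text \<open>The shift forgets only the value at \<open>(r, b)\<close>, which is 0 before the slide
  there.\<close>

lemma hook_unshift_shift: "r \<le> a \<Longrightarrow> H (r, b) = 0 \<Longrightarrow> hook_unshift r b a (hook_shift r b a c H) = H"
  by (auto simp: hook_unshift_def hook_shift_def fun_eq_iff)

lemma hook_shift_unshift:
  "r \<le> a \<Longrightarrow> H (a, b) = int c - int b \<Longrightarrow> hook_shift r b a c (hook_unshift r b a H) = H"
  by (auto simp: hook_unshift_def hook_shift_def fun_eq_iff)

text \<open>The rows \<open>i\<close> whose hook value encodes a possible final cell \<open>(i, cand_col b H i)\<close>.\<close>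
definition cand_col :: "nat \<Rightarrow> (cell \<Rightarrow> int) \<Rightarrow> nat \<Rightarrow> nat" where
  "cand_col b H i = b + nat (H (i, b))"

lemma cand_col_ge: "b \<le> cand_col b H i"
  by (simp add: cand_col_def)

context young
begin

definition cand :: "nat \<Rightarrow> nat \<Rightarrow> (cell \<Rightarrow> int) \<Rightarrow> nat set" where
  "cand r b H = {i. r \<le> i \<and> (i, b) \<in> D \<and> 0 \<le> H (i, b)}"

definition valid :: "nat \<Rightarrow> nat \<Rightarrow> (cell \<Rightarrow> int) \<Rightarrow> bool" where
  "valid r b H \<longleftrightarrow> (\<forall>x. (x \<in> reg r b \<longrightarrow> - int (leg lam x) \<le> H x \<and> H x \<le> int (arm lam x)) \<and>
     (x \<notin> reg r b \<longrightarrow> H x = 0))"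

text \<open>The pairs that occur just before the slide at the cell above \<open>(r, b)\<close>. The last condition
  says that the reverse paths of all candidates arrive at \<open>(r, b)\<close>.\<close>
definition stage :: "nat \<Rightarrow> nat \<Rightarrow> ((cell \<Rightarrow> nat) \<times> (cell \<Rightarrow> int)) set" where
  "stage r b = {(T, H). T \<in> tabloids lam \<and> srt r b T \<and> valid r b H \<and>
     (\<forall>i\<in>cand r b H. entry_col T b i (cand_col b H i) (r - 1) = b)}"

lemma cand_col_D:
  assumes "valid r b H" "i \<in> cand r b H"
  shows "(i, cand_col b H i) \<in> D"
proof -
  have i: "(i, b) \<in> D" "0 \<le> H (i, b)" "(i, b) \<in> reg r b" using assms by (auto simp: cand_def)
  then have "H (i, b) \<le> int (arm lam (i, b))" using assms unfolding valid_def by blast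
  then show ?thesis
    using i by (intro arm_D[THEN iffD1, OF i(1)]) (auto simp: cand_col_def)
qed

lemma arm_antimono: "(p, b) \<in> D \<Longrightarrow> 1 \<le> p' \<Longrightarrow> p' \<le> p \<Longrightarrow> arm lam (p, b) \<le> arm lam (p', b)"
  using rowlen_antimono[of p' p] by (simp add: arm_def)

end

section \<open>Hook values along one slide\<close>

context slid
begin

lemma col_D: "1 \<le> p \<Longrightarrow> p \<le> a \<Longrightarrow> (p, b) \<in> D"
  using D_down[OF final, of p b] D_pos[OF start(1)] m_ge[of "Suc a"] start by auto

lemma m_path: "r \<le> Suc p \<Longrightarrow> p \<le> a \<Longrightarrow> m (Suc p) = entry_col S b a (m (Suc a)) p"
  using entry_col_path by simp

text \<open>Inverts \<open>shift\<close>: the filling before the slide is a function of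
  \<open>S\<close> and the path alone.\<close>

lemma T_eq: "T = (\<lambda>(p, q). if (p, q) = (r, b) then S (a, m (Suc a))
    else if r \<le> p \<and> p \<le> a \<and> m p < q \<and> q \<le> m (Suc p) then S (p, q - 1)
    else if r < p \<and> p \<le> a \<and> q = m p then S (p - 1, q) else S (p, q))"
proof
  fix u :: cell
  obtain p q where u: "u = (p, q)" by (cases u)
  consider "(p, q) = (r, b)" | "(p, q) \<noteq> (r, b)" "r \<le> p" "p \<le> a" "m p < q" "q \<le> m (Suc p)"
    | "(p, q) \<noteq> (r, b)" "r < p" "p \<le> a" "q = m p"
    | "\<not> (r \<le> p \<and> p \<le> a \<and> m p \<le> q \<and> q \<le> m (Suc p))"
    using start by force
  then show "T u = (case u of (p, q) \<Rightarrow> if (p, q) = (r, b) then S (a, m (Suc a))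
    else if r \<le> p \<and> p \<le> a \<and> m p < q \<and> q \<le> m (Suc p) then S (p, q - 1)
    else if r < p \<and> p \<le> a \<and> q = m p then S (p - 1, q) else S (p, q))"
  proof cases
    case 1
    then show ?thesis using S_final u by simp
  next
    case 2
    then show ?thesis using S_right[of p "q - 1"] u by auto
  next
    case 3
    then show ?thesis using S_down[of "p - 1"] u by auto
  next
    case 4
    then show ?thesis using S_off[of p q] u start mono[of p] by auto
  qed
qed

text \<open>By \<open>entry_side_above\<close> an old candidate in row \<open>Suc i \<le> a\<close>
  has column at most \<open>m (Suc i)\<close>, so its recoding in row \<open>i\<close> is strictly
  left of the path; by \<open>entry_side_below\<close> the candidates under row \<open>a\<close>
  have paths weakly left of the final cell. So \<open>a\<close> is dominant, and
  \<open>dominant_reach\<close> carries the reachability over to all new candidates.\<close>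

lemma hook_step:
  assumes val: "valid (Suc r) b H"
    and reach: "\<And>i. i \<in> cand (Suc r) b H \<Longrightarrow> entry_col T b i (cand_col b H i) r = b"
  defines "H' \<equiv> hook_shift r b a (m (Suc a)) H"
  shows "valid r b H'"
    and "dominant S b (cand r b H') (cand_col b H') a"
    and "cand_col b H' a = m (Suc a)"
    and "(S, H') \<in> stage r b"
proof -
  have mb: "b \<le> m (Suc a)" using m_ge start by simp
  have r1: "1 \<le> r" using D_pos[OF start(1)] by simp
  have Ha: "H' (a, b) = int (m (Suc a)) - int b" by (simp add: H'_def hook_shift_def)
  have Hless: "H' (i, b) = H (Suc i, b) - 1" if "r \<le> i" "i < a" for i
    using that by (simp add: H'_def hook_shift_def)
  have Hgr: "H' (p, q) = H (p, q)" if "q \<noteq> b \<or> a < p \<or> p < r" for p q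
    using that start by (auto simp: H'_def hook_shift_def)
  have bounds: "- int (leg lam x) \<le> H x \<and> H x \<le> int (arm lam x)" if "x \<in> reg (Suc r) b" for x
    using val that unfolding valid_def by blast
  have zero: "H x = 0" if "x \<notin> reg (Suc r) b" for x
    using val that unfolding valid_def by blast
  show v: "valid r b H'"
    unfolding valid_def
  proof (intro allI conjI impI)
    fix x assume x: "x \<in> reg r b"
    obtain p q where pq: "x = (p, q)" by (cases x)
    have "- int (leg lam x) \<le> H' x \<and> H' x \<le> int (arm lam x)"
    proof (cases "q = b \<and> p \<le> a")
      case True
      show ?thesis
      proof (cases "p = a")
        case pa: True
        have "int (m (Suc a)) \<le> int b + int (arm lam (a, b))"
          using arm_D[of a b "m (Suc a)"] final mb x pq True pa by simp
        then show ?thesis using Ha mb pq pa True by auto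
      next
        case False
        have 1: "(Suc p, b) \<in> D" "(Suc p, b) \<in> reg (Suc r) b"
          using col_D[of "Suc p"] True False x pq by auto
        then show ?thesis
          using bounds[OF 1(2)] Hless[of p] leg_Suc[OF 1(1)] arm_antimono[OF 1(1), of p] x pq True False r1
          by auto
      qed
    next
      case False
      have "H' x = H x" using Hgr[of q p] False pq by auto
      moreover have "x \<in> reg (Suc r) b" using False x pq start by auto
      ultimately show ?thesis using bounds by simp
    qed
    then show "- int (leg lam x) \<le> H' x" "H' x \<le> int (arm lam x)" by auto
  next
    fix x assume x: "x \<notin> reg r b"
    obtain p q where pq: "x = (p, q)" by (cases x)
    have "H' x = H x"
      using x col_D[of p] r1 pq Hgr[of q p] by (cases "q = b \<and> r \<le> p \<and> p \<le> a") auto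
    moreover have "x \<notin> reg (Suc r) b" using x pq by auto
    ultimately show "H' x = 0" using zero by simp
  qed
  have aD: "(a, b) \<in> D" using col_D[of a] start r1 by simp
  show ca: "cand_col b H' a = m (Suc a)" using Ha mb by (simp add: cand_col_def)
  have ac: "a \<in> cand r b H'" using aD start Ha mb by (simp add: cand_def)
  show dom: "dominant S b (cand r b H') (cand_col b H') a"
    unfolding dominant_def
  proof (intro conjI ballI impI ac)
    fix i assume i: "i \<in> cand r b H'" "i < a"
    have ri: "r \<le> i" using i by (simp add: cand_def)
    have Hi: "1 \<le> H (Suc i, b)" using i Hless[of i] ri by (simp add: cand_def)
    have si: "Suc i \<in> cand (Suc r) b H" using i ri Hi col_D[of "Suc i"] by (simp add: cand_def)
    have "cand_col b H (Suc i) \<le> m (Suc i)"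
      using entry_side_above[of "Suc i" "cand_col b H (Suc i)"] reach[OF si] cand_col_D[OF val si]
        cand_col_ge ri i by simp
    moreover have "cand_col b H (Suc i) = Suc (cand_col b H' i)"
      using Hless[of i] ri i Hi by (simp add: cand_col_def)
    ultimately show "cand_col b H' i < entry_col S b a (cand_col b H' a) i"
      using m_path[of i] ri i ca by simp
  next
    fix i assume i: "i \<in> cand r b H'" "a < i"
    have "i \<in> cand (Suc r) b H" "cand_col b H' i = cand_col b H i"
      using i start Hgr[of b i] by (auto simp: cand_def cand_col_def)
    then show "entry_col S b i (cand_col b H' i) a \<le> cand_col b H' a"
      using entry_side_below[OF i(2), of "cand_col b H i"] reach[of i] cand_col_D[OF val] cand_col_ge ca by simp
  qed
  have "entry_col S b i (cand_col b H' i) (r - 1) = b" if "i \<in> cand r b H'" for i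
  proof (rule dominant_reach[OF dom _ that])
    show "entry_col S b a (cand_col b H' a) (r - 1) = b" using entry_col_path_end ca by simp
    show "r - 1 \<le> i \<and> b \<le> cand_col b H' i" if "i \<in> cand r b H'" for i
      using that cand_col_ge by (auto simp: cand_def)
  qed
  then show "(S, H') \<in> stage r b" using v S srtS by (auto simp: stage_def)
qed

text \<open>The side criteria used in \<open>hook_step\<close> are equivalences, so dominance of
  \<open>a\<close> gives back reachability before the slide.\<close>

lemma hook_step_back:
  assumes val: "valid r b H'"
    and dom: "dominant S b (cand r b H') (cand_col b H') a"
    and ca: "cand_col b H' a = m (Suc a)"
  shows "(T, hook_unshift r b a H') \<in> stage (Suc r) b"
    and "hook_shift r b a (m (Suc a)) (hook_unshift r b a H') = H'"
proof -
  define H where "H = hook_unshift r b a H'"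
  have r1: "1 \<le> r" using D_pos[OF start(1)] by simp
  have ac: "a \<in> cand r b H'" using dom by (simp add: dominant_def)
  show "hook_shift r b a (m (Suc a)) (hook_unshift r b a H') = H'"
    by (rule hook_shift_unshift) (use ac ca start in \<open>auto simp: cand_def cand_col_def\<close>)
  have bounds: "- int (leg lam x) \<le> H' x \<and> H' x \<le> int (arm lam x)" if "x \<in> reg r b" for x
    using val that unfolding valid_def by blast
  have zero: "H' x = 0" if "x \<notin> reg r b" for x
    using val that unfolding valid_def by blast
  have Hless: "H (Suc i, b) = H' (i, b) + 1" if "r \<le> i" "i < a" for i
    using that by (simp add: H_def hook_unshift_def)
  have Hr: "H (r, b) = 0" by (simp add: H_def hook_unshift_def)
  have Hgr: "H (p, q) = H' (p, q)" if "q \<noteq> b \<or> a < p \<or> p < r" for p q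
    using that start by (auto simp: H_def hook_unshift_def)
  have left: "cand_col b H' i < m (Suc i)" if "i \<in> cand r b H'" "i < a" for i
    using dom that m_path[of i] ca by (auto simp: dominant_def cand_def)
  have v: "valid (Suc r) b H"
    unfolding valid_def
  proof (intro allI conjI impI)
    fix x assume x: "x \<in> reg (Suc r) b"
    obtain p q where pq: "x = (p, q)" by (cases x)
    have "- int (leg lam x) \<le> H x \<and> H x \<le> int (arm lam x)"
    proof (cases "q = b \<and> p \<le> a")
      case True
      then obtain i where i: "p = Suc i" "r \<le> i" "i < a" using x pq by (cases p) auto
      have D1: "(Suc i, b) \<in> D" "(i, b) \<in> D" "(i, b) \<in> reg r b"
        using col_D[of "Suc i"] col_D[of i] i r1 by auto
      \<comment> \<open>The row below may be shorter, so the bound for \<open>H' (i, b)\<close> is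
        not enough. Dominance puts the candidate strictly left of \<open>m (Suc i)\<close>, and
        \<open>(Suc i, m (Suc i))\<close> is a cell of the diagram.\<close>
      have "H' (i, b) + 1 \<le> int (arm lam (Suc i, b))"
      proof (cases "0 \<le> H' (i, b)")
        case True
        then have ic: "i \<in> cand r b H'" using i D1 by (simp add: cand_def)
        have "int (m (Suc i)) \<le> int b + int (arm lam (Suc i, b))"
          using arm_D[of "Suc i" b "m (Suc i)"] D1 m_ge[of "Suc i"] i path_D[of "Suc i" "m (Suc i)"] mono[of "Suc i"]
          by simp
        then show ?thesis using left[OF ic] i True by (simp add: cand_col_def)
      qed simp
      then show ?thesis using bounds[OF D1(3)] Hless[of i] i pq True leg_Suc[OF D1(1)] by simp
    next
      case False
      have "H x = H' x" using Hgr[of q p] False pq by auto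
      moreover have "x \<in> reg r b" using x pq by auto
      ultimately show ?thesis using bounds by simp
    qed
    then show "- int (leg lam x) \<le> H x" "H x \<le> int (arm lam x)" by auto
  next
    fix x assume x: "x \<notin> reg (Suc r) b"
    obtain p q where pq: "x = (p, q)" by (cases x)
    show "H x = 0"
    proof (cases "x = (r, b)")
      case False
      have "H x = H' x"
        using x col_D[of p] r1 pq Hgr[of q p] False by (cases "q = b \<and> r \<le> p \<and> p \<le> a") auto
      moreover have "x \<notin> reg r b" using x pq False by auto
      ultimately show ?thesis using zero by simp
    qed (simp add: Hr)
  qed
  have "entry_col T b i (cand_col b H i) r = b" if i: "i \<in> cand (Suc r) b H" for i
  proof (cases "i \<le> a")
    case True
    then obtain k where k: "i = Suc k" "r \<le> k" "k < a" using i by (cases i) (auto simp: cand_def)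
    show ?thesis
    proof (cases "0 \<le> H' (k, b)")
      case True
      then have kc: "k \<in> cand r b H'" using k col_D[of k] r1 by (simp add: cand_def)
      have "cand_col b H i \<le> m i"
        using left[OF kc] Hless[of k] k True by (simp add: cand_col_def nat_add_distrib)
      then show ?thesis
        using entry_side_above[of i "cand_col b H i"] k cand_col_D[OF v i] cand_col_ge by simp
    next
      case False
      \<comment> \<open>A negative value that becomes nonnegative becomes 0: a candidate in column
        \<open>b\<close> itself, whose reverse path goes straight up.\<close>
      then have "cand_col b H i = b" using Hless[of k] k by (simp add: cand_col_def)
      then show ?thesis using entry_col_at_b[of r i T b] k by simp
    qed
  next
    case False
    then have "i \<in> cand r b H'" "cand_col b H i = cand_col b H' i"
      using i Hgr[of b i] by (auto simp: cand_def cand_col_def)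
    then show ?thesis
      using dom False ca entry_side_below[of i "cand_col b H i"] cand_col_D[OF v i] cand_col_ge
      by (auto simp: dominant_def)
  qed
  then show "(T, hook_unshift r b a H') \<in> stage (Suc r) b"
    using v T srtT unfolding H_def[symmetric] by (auto simp: stage_def)
qed

end

context young
begin

lemma slide_slid:
  assumes "T \<in> tabloids lam" "srt (Suc r) b T" "(r, b) \<in> D"
  obtains m a S where "slid lam n r b a m T S"
    "slide (sum_list lam) lam T (r, b) = (S, (a, m (Suc a)))"
proof -
  obtain m a where m: "m r = b" "r \<le> a" "\<And>p. r \<le> p \<Longrightarrow> p \<le> a \<Longrightarrow> m p \<le> m (Suc p)"
    "(a, m (Suc a)) \<in> D"
    "slide (sum_list lam) lam T (r, b) = (shift r m a T, (a, m (Suc a)))"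
    using slide_shift[OF assms(3)] by metis
  have "shift r m a T \<in> tabloids lam"
    using slide_tabloid[OF assms(1,3), of "sum_list lam"] m(5) by simp
  moreover have "srt r b (shift r m a T)"
    using slide_srt[OF _ assms(1) mu_le[OF assms(1)], of r b "(r, b)"] asrt_start assms m(5) by simp
  ultimately have "slid lam n r b a m T (shift r m a T)"
    using assms m by unfold_locales auto
  then show thesis using that m(5) by blast
qed

lemma nps_step_eq:
  assumes "slide (sum_list lam) lam T (r, b) = (S, (a, c))"
  shows "nps_step lam (T, H) (r, b) = (S, hook_shift r b a c H)"
  using assms by (auto simp: nps_step_def hook_shift_def Let_def fun_eq_iff)

text \<open>The reverse slide, built by undoing one exchange after the other.\<close>
lemma reverse_slide:
  assumes S: "S \<in> tabloids lam" "srt r b S" and rb: "(r, b) \<in> D"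
    and ac: "(a, c) \<in> D" "r \<le> a" "b \<le> c" and reach: "entry_col S b a c (r - 1) = b"
  obtains T where "T \<in> tabloids lam" "srt (Suc r) b T"
    "slide (sum_list lam) lam T (r, b) = (S, (a, c))"
proof -
  \<comment> \<open>\<open>Q w\<close>: the slide has been undone back to \<open>w\<close>.
    Agreement with \<open>S\<close> outside the southeast of \<open>w\<close> lets comparisons in
    \<open>S\<close> choose the next backward step.\<close>
  define Q where "Q = (\<lambda>w. \<exists>T \<in> tabloids lam. asrt r b T w \<and>
    (\<forall>f\<ge>mu w. slide f lam T w = (S, (a, c))) \<and>
    (\<forall>u. \<not> (fst w \<le> fst u \<and> snd w \<le> snd u) \<longrightarrow> T u = S u))"
  have undo: "Q w" if Q: "Q v" and w: "w \<in> reg r b" "adj w v"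
    and large: "\<And>u. u \<in> reg r b \<Longrightarrow> adj u v \<Longrightarrow> u \<noteq> w \<Longrightarrow> S u < S w" for v w
  proof -
    obtain T where T: "T \<in> tabloids lam" "asrt r b T v" "\<And>f. mu v \<le> f \<Longrightarrow> slide f lam T v = (S, (a, c))"
      "\<And>u. \<not> (fst v \<le> fst u \<and> snd v \<le> snd u) \<Longrightarrow> T u = S u"
      using Q unfolding Q_def by blast
    have ST: "T u = S u" if "adj u v" for u using that T(4)[of u] by (auto simp: adj_def)
    let ?T = "T(v := T w, w := T v)"
    have large': "T u < T w" if "u \<in> reg r b" "adj u v" "u \<noteq> w" for u
      using large that ST w by simp
    have vw: "v \<in> D" "w \<in> D" using asrtD(2)[OF T(2)] w reg_D by auto
    have "?T \<in> tabloids lam" using tabloid_swap[OF T(1)] vw by blast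
    moreover have "asrt r b ?T w" using asrt_back(1)[OF T(2) w large'] by blast
    moreover have "slide f lam ?T w = (S, (a, c))" if f: "mu w \<le> f" for f
    proof -
      obtain g where g: "f = Suc g" "mu v \<le> g"
        using f mu_adj[OF vw(2) w(2)] by (cases f) auto
      show ?thesis using asrt_back(2)[OF T(2) w large', of g] T(3)[OF g(2)] g(1) by simp
    qed
    moreover have "?T u = S u" if "\<not> (fst w \<le> fst u \<and> snd w \<le> snd u)" for u
    proof -
      have "u \<noteq> w" "u \<noteq> v" "\<not> (fst v \<le> fst u \<and> snd v \<le> snd u)"
        using that w(2) by (auto simp: adj_def)
      then show ?thesis using T(4) by simp
    qed
    ultimately show ?thesis unfolding Q_def by blast
  qed
  have inj: "S u \<noteq> S v" if "u \<in> D" "v \<in> D" "u \<noteq> v" for u v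
    using inj_onD[OF tabloid_inj[OF S(1)]] that by blast
  have acr: "(a, c) \<in> reg r b" using ac by auto
  have stop: "slide f lam S (a, c) = (S, (a, c))" for f
    by (rule slide_stopI) (use S(2) acr in \<open>meson srt_def less_imp_le\<close>)
  have Qstart: "Q (a, c)"
    unfolding Q_def by (rule bexI[OF _ S(1)]) (use srt_asrt[OF S(2) acr] stop in auto)
  have row: "Q (p, exit_col S b p q)" if Q: "Q (p, q)" "(p, q) \<in> D" "r \<le> p" "b \<le> q" for p q
  proof -
    have ex: "b \<le> exit_col S b p q" "exit_col S b p q \<le> q" using exit_col_props that by auto
    have "Q (p, y)" if "exit_col S b p q \<le> y" "y \<le> q" for y
      using that(2,1)
    proof (induction y rule: inc_induct)
      case (step y)
      have y: "(p, Suc y) \<in> D" "(p, y) \<in> reg r b"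
        using D_down[OF Q(2), of p] D_pos[OF rb] ex step Q by auto
      show ?case
      proof (rule undo[of "(p, Suc y)"])
        fix u assume u: "u \<in> reg r b" "adj u (p, Suc y)" "u \<noteq> (p, y)"
        have u': "u = (p - 1, Suc y)" using u by (cases u) auto
        have "\<not> S (p, y) < S u"
          using exit_col_ge[of b "Suc y" q S p] step ex unfolding u' by auto
        then show "S u < S (p, y)"
          using inj[of u "(p, y)"] u y reg_D by (auto simp: not_less le_less)
      qed (use y step in \<open>auto\<close>)
    qed (use Q in auto)
    then show ?thesis using ex by blast
  qed
  have main: "Q (p, entry_col S b a c p)" if "r \<le> p" "p \<le> a" for p
    using that(2,1)
  proof (induction p rule: inc_induct)
    case (step p)
    let ?q = "entry_col S b a c (Suc p)" and ?y = "entry_col S b a c p"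
    have y: "?y = exit_col S b (Suc p) ?q" using step by (simp add: entry_col_step)
    have b: "b \<le> ?q" "?q \<le> c" using entry_col_bounds[of b c "Suc p" a S] ac step by auto
    have qD: "(Suc p, ?q) \<in> D"
      using D_down[OF ac(1), of "Suc p"] b D_pos[OF rb] step by auto
    have Qy: "Q (Suc p, ?y)" using row[of "Suc p" ?q] step qD b y by simp
    have ex: "b \<le> ?y" "?y \<le> ?q" "?y = b \<or> S (Suc p, ?y - 1) < S (p, ?y)"
      using exit_col_props[OF b(1), of S "Suc p"] y by auto
    have yD: "(p, ?y) \<in> reg r b"
      using D_down[OF qD, of p ?y] ex D_pos[OF rb] step by auto
    show ?case
    proof (rule undo[OF Qy yD])
      fix u assume u: "u \<in> reg r b" "adj u (Suc p, ?y)" "u \<noteq> (p, ?y)"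
      then have "u = (Suc p, ?y - 1)" "?y \<noteq> b" by (cases u; auto)+
      then show "S u < S (p, ?y)" using ex by simp
    qed simp
  qed (use Qstart in simp)
  \<comment> \<open>\<open>main\<close> ends where the reverse path enters row \<open>r\<close>;
    \<open>reach\<close> says that the remaining walk left ends in column \<open>b\<close>.\<close>
  have "r - 1 < a" "Suc (r - 1) = r" using ac D_pos[OF rb] by auto
  then have "b = exit_col S b r (entry_col S b a c r)"
    using reach entry_col_step[of "r - 1" a S b c] by simp
  moreover have "(r, entry_col S b a c r) \<in> D" "b \<le> entry_col S b a c r"
    using entry_col_bounds[of b c r a S] ac D_down[OF ac(1), of r] D_pos[OF rb] by auto
  ultimately have "Q (r, b)" using row[OF main[of r]] ac by simp
  then show thesis
    using that asrt_start[OF rb] mu_le unfolding Q_def by blast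
qed

text \<open>Injectivity: the output determines the final row as the unique dominant one, its column
  by the hook value, then the path as a reverse path, and so \<open>T\<close> and \<open>H\<close>.
  Surjectivity: a dominant row exists, and reversing the slide from its candidate leads back into
  the previous stage.\<close>

lemma nps_step_bij:
  assumes rb: "(r, b) \<in> D"
  shows "bij_betw (\<lambda>TH. nps_step lam TH (r, b)) (stage (Suc r) b) (stage r b)"
  unfolding bij_betw_def
proof
  have step: thesis
    if TH: "(T, H) \<in> stage (Suc r) b"
      and ths: "\<And>m a S. slid lam n r b a m T S \<Longrightarrow>
        nps_step lam (T, H) (r, b) = (S, hook_shift r b a (m (Suc a)) H) \<Longrightarrow> thesis" for T H thesis
  proof -
    have "T \<in> tabloids lam" "srt (Suc r) b T" using TH by (auto simp: stage_def)
    from slide_slid[OF this rb] show thesis using ths nps_step_eq by metis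
  qed
  show "inj_on (\<lambda>TH. nps_step lam TH (r, b)) (stage (Suc r) b)"
  proof (rule inj_onI, clarify)
    fix T\<^sub>1 H\<^sub>1 T\<^sub>2 H\<^sub>2
    assume st: "(T\<^sub>1, H\<^sub>1) \<in> stage (Suc r) b" "(T\<^sub>2, H\<^sub>2) \<in> stage (Suc r) b"
      and eq: "nps_step lam (T\<^sub>1, H\<^sub>1) (r, b) = nps_step lam (T\<^sub>2, H\<^sub>2) (r, b)"
    obtain m\<^sub>1 a\<^sub>1 S where s1: "slid lam n r b a\<^sub>1 m\<^sub>1 T\<^sub>1 S"
      "nps_step lam (T\<^sub>1, H\<^sub>1) (r, b) = (S, hook_shift r b a\<^sub>1 (m\<^sub>1 (Suc a\<^sub>1)) H\<^sub>1)"
      using step[OF st(1)] by metis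
    obtain m\<^sub>2 a\<^sub>2 where s2: "slid lam n r b a\<^sub>2 m\<^sub>2 T\<^sub>2 S"
      "nps_step lam (T\<^sub>2, H\<^sub>2) (r, b) = (S, hook_shift r b a\<^sub>2 (m\<^sub>2 (Suc a\<^sub>2)) H\<^sub>2)"
      using step[OF st(2)] eq s1(2) by (metis fst_conv)
    interpret s1: slid lam n r b a\<^sub>1 m\<^sub>1 T\<^sub>1 S by (rule s1(1))
    interpret s2: slid lam n r b a\<^sub>2 m\<^sub>2 T\<^sub>2 S by (rule s2(1))
    let ?H = "hook_shift r b a\<^sub>1 (m\<^sub>1 (Suc a\<^sub>1)) H\<^sub>1"
    have H2: "hook_shift r b a\<^sub>2 (m\<^sub>2 (Suc a\<^sub>2)) H\<^sub>2 = ?H" using eq s1(2) s2(2) by simp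
    have val: "valid (Suc r) b H\<^sub>1" "valid (Suc r) b H\<^sub>2"
      and reach: "\<And>i. i \<in> cand (Suc r) b H\<^sub>1 \<Longrightarrow> entry_col T\<^sub>1 b i (cand_col b H\<^sub>1 i) r = b"
        "\<And>i. i \<in> cand (Suc r) b H\<^sub>2 \<Longrightarrow> entry_col T\<^sub>2 b i (cand_col b H\<^sub>2 i) r = b"
      using st by (auto simp: stage_def)
    note h1 = s1.hook_step[OF val(1) reach(1)] and h2 = s2.hook_step[OF val(2) reach(2), unfolded H2]
    have a: "a\<^sub>1 = a\<^sub>2" using dominant_unique[OF h1(2) h2(2)] .
    then have ma: "m\<^sub>1 (Suc a\<^sub>1) = m\<^sub>2 (Suc a\<^sub>1)" using h1(3) h2(3) by simp
    have m: "m\<^sub>1 p = m\<^sub>2 p" if p: "r \<le> p" "p \<le> Suc a\<^sub>1" for p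
    proof -
      obtain k where "p = Suc k" using p D_pos[OF rb] by (cases p) simp_all
      then show ?thesis using s1.m_path[of k] s2.m_path[of k] p a ma by simp
    qed
    have "T\<^sub>1 = T\<^sub>2"
      using s1.start(3) a m by (subst s1.T_eq, subst s2.T_eq) (auto simp: fun_eq_iff)
    moreover have "(r, b) \<notin> reg (Suc r) b" by simp
    then have "H\<^sub>1 (r, b) = 0" "H\<^sub>2 (r, b) = 0" using val unfolding valid_def by blast+
    then have "H\<^sub>1 = H\<^sub>2"
      using hook_unshift_shift[of r a\<^sub>1 H\<^sub>1 b] hook_unshift_shift[of r a\<^sub>2 H\<^sub>2 b] H2 a s1.start(3)
      by metis
    ultimately show "T\<^sub>1 = T\<^sub>2 \<and> H\<^sub>1 = H\<^sub>2" by simp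
  qed
  show "(\<lambda>TH. nps_step lam TH (r, b)) ` stage (Suc r) b = stage r b"
  proof (intro equalityI subsetI)
    fix SH assume "SH \<in> (\<lambda>TH. nps_step lam TH (r, b)) ` stage (Suc r) b"
    then obtain T H where TH: "(T, H) \<in> stage (Suc r) b" "SH = nps_step lam (T, H) (r, b)" by auto
    obtain m a S where s: "slid lam n r b a m T S" "SH = (S, hook_shift r b a (m (Suc a)) H)"
      using step[OF TH(1)] TH(2) by metis
    show "SH \<in> stage r b"
      using slid.hook_step(4)[OF s(1)] TH(1) s(2) by (auto simp: stage_def)
  next
    fix SH assume SH: "SH \<in> stage r b"
    obtain S H where SH': "SH = (S, H)" by (cases SH)
    have S: "S \<in> tabloids lam" "srt r b S" "valid r b H"
      "\<And>i. i \<in> cand r b H \<Longrightarrow> entry_col S b i (cand_col b H i) (r - 1) = b"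
      using SH SH' by (auto simp: stage_def)
    \<comment> \<open>The bottom cell of the column has leg 0, so its hook value is nonnegative and
      there is at least one candidate.\<close>
    have "(collen lam b, b) \<in> reg r b" using rb by (auto simp: D_iff_col)
    then have "0 \<le> H (collen lam b, b)"
      using S(3) unfolding valid_def by (force simp: leg_def)
    then have "collen lam b \<in> cand r b H" using rb by (auto simp: D_iff_col cand_def)
    moreover have "finite (cand r b H)"
      by (rule finite_subset[of _ "{..collen lam b}"]) (auto simp: cand_def D_iff_col)
    ultimately obtain a where dom: "dominant S b (cand r b H) (cand_col b H) a"
      using dominant_exists[of "cand r b H" b "cand_col b H" S] cand_col_ge by blast
    then have ac: "a \<in> cand r b H" by (simp add: dominant_def)
    obtain T where T: "T \<in> tabloids lam" "srt (Suc r) b T"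
      "slide (sum_list lam) lam T (r, b) = (S, (a, cand_col b H a))"
      using reverse_slide[OF S(1,2) rb cand_col_D[OF S(3) ac] _ _ S(4)[OF ac]] ac cand_col_ge
      by (auto simp: cand_def)
    obtain m a' S' where s: "slid lam n r b a' m T S'"
      "slide (sum_list lam) lam T (r, b) = (S', (a', m (Suc a')))"
      using slide_slid[OF T(1,2) rb] by metis
    have e: "S' = S" "a' = a" "m (Suc a) = cand_col b H a" using s(2) T(3) by auto
    have "slid lam n r b a m T S" using s(1) e by simp
    note hb = slid.hook_step_back[OF this S(3) dom e(3)[symmetric]]
    have "nps_step lam (T, hook_unshift r b a H) (r, b) = (S, H)"
      using nps_step_eq[OF T(3)] hb(2) e(3) by simp
    then show "SH \<in> (\<lambda>TH. nps_step lam TH (r, b)) ` stage (Suc r) b"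
      using hb(1) SH' by force
  qed
qed

end

section \<open>The Novelli--Pak--Stoyanovskii map is bijective\<close>

context young
begin

text \<open>Row 0 carries the default value 0, which never exceeds a left neighbour, so row 1 is
  left only in column \<open>b\<close>.\<close>

lemma entry_col_top:
  assumes "T \<in> tabloids lam" "1 \<le> i" "b \<le> q"
  shows "entry_col T b i q 0 = b"
proof -
  have "T (0, y) = 0" for y using assms(1) by (auto simp: tabloids_def diagram_def)
  then have "exit_col T b (Suc 0) (entry_col T b i q (Suc 0)) \<le> b"
    using entry_col_bounds[OF assms(3), of "Suc 0" i T] assms(2) by (subst exit_col_le_iff) auto
  then show ?thesis
    using entry_col_bounds[OF assms(3), of 0 i T] assms(2) by (simp add: entry_col_step)
qed

text \<open>Here the candidates change columns: below the end of column \<open>b\<close> there are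
  none, and those of the complete column \<open>Suc b\<close> satisfy the reachability condition by
  \<open>entry_col_top\<close>.\<close>

lemma stage_next_col:
  assumes "1 \<le> b"
  shows "stage (Suc (collen lam b)) b = stage 1 (Suc b)"
proof -
  have reg: "reg (Suc (collen lam b)) b = reg 1 (Suc b)"
    by (auto simp: reg_def D_iff_col)
  have "cand (Suc (collen lam b)) b H = {}" for H
    by (auto simp: cand_def D_iff_col)
  moreover have "entry_col T (Suc b) i (cand_col (Suc b) H i) (1 - 1) = Suc b"
    if "T \<in> tabloids lam" "i \<in> cand 1 (Suc b) H" for T H i
    using entry_col_top[OF that(1), of i] that(2) cand_col_ge by (simp add: cand_def)
  ultimately show ?thesis
    unfolding stage_def srt_def valid_def reg by auto
qed

abbreviation "ncols \<equiv> rowlen lam 1"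

definition cells_from :: "nat \<Rightarrow> nat \<Rightarrow> cell list" where
  "cells_from r b = map (\<lambda>i. (i, b)) [r..<Suc (collen lam b)] @
     concat (map (\<lambda>j. map (\<lambda>i. (i, j)) [1..<Suc (collen lam j)]) [Suc b..<Suc ncols])"

lemma D_col_le: "(i, j) \<in> D \<Longrightarrow> j \<le> ncols"
  using rowlen_antimono[of 1 i] by (simp add: D_iff_row)

lemma collen_beyond: "collen lam (Suc ncols) = 0"
proof (rule ccontr)
  assume "collen lam (Suc ncols) \<noteq> 0"
  then have "(1, Suc ncols) \<in> D" by (simp add: D_iff_col)
  then show False using D_col_le by fastforce
qed

lemma cells_from_Cons: "r \<le> collen lam b \<Longrightarrow> cells_from r b = (r, b) # cells_from (Suc r) b"
  by (simp add: cells_from_def upt_conv_Cons del: upt_Suc)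

lemma cells_from_next_col:
  assumes "b \<le> ncols"
  shows "cells_from (Suc (collen lam b)) b = cells_from 1 (Suc b)"
proof (cases "b = ncols")
  case True
  then show ?thesis using collen_beyond by (simp add: cells_from_def)
next
  case False
  then have "[Suc b..<Suc ncols] = Suc b # [Suc (Suc b)..<Suc ncols]"
    using assms by (simp add: upt_conv_Cons del: upt_Suc)
  then show ?thesis by (simp add: cells_from_def del: upt_Suc)
qed

lemma cells_eq: "cells lam = cells_from 1 1" if "D \<noteq> {}"
proof -
  have "1 \<le> ncols" using that D_col_le D_pos by fastforce
  then have "[1..<Suc ncols] = 1 # [Suc 1..<Suc ncols]"
    by (simp add: upt_conv_Cons del: upt_Suc)
  then show ?thesis by (simp add: cells_def cells_from_def del: upt_Suc)
qed

lemma cells_split: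
  assumes "(r, b) \<in> D"
  obtains pre where "cells lam = pre @ (r, b) # cells_from (Suc r) b"
proof -
  have b: "1 \<le> b" "b \<le> ncols" "1 \<le> r" "r \<le> collen lam b"
    using assms D_col_le by (auto simp: D_iff_col)
  have "[1..<Suc ncols] = [1..<b] @ b # [Suc b..<Suc ncols]"
    using b by (intro upt_split) auto
  moreover have "[1..<Suc (collen lam b)] = [1..<r] @ r # [Suc r..<Suc (collen lam b)]"
    using b by (intro upt_split) auto
  ultimately show thesis
    by (intro that[of "concat (map (\<lambda>j. map (\<lambda>i. (i, j)) [1..<Suc (collen lam j)]) [1..<b]) @
        map (\<lambda>i. (i, b)) [1..<r]"])
      (simp add: cells_def cells_from_def del: upt_Suc)
qed

lemma distinct_cells: "distinct (cells lam)"
proof -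
  have "distinct (concat (map (\<lambda>j. map (\<lambda>i. (i, j)) [1..<Suc (f j)]) js))"
    if "distinct js" for f :: "nat \<Rightarrow> nat" and js :: "nat list"
    using that by (induction js) (auto simp: distinct_map inj_on_def simp del: upt_Suc)
  then show ?thesis by (simp add: cells_def del: upt_Suc)
qed

lemma set_cells: "set (cells lam) = D"
proof (intro equalityI subsetI)
  fix u assume "u \<in> set (cells lam)"
  then show "u \<in> D" by (auto simp: cells_def D_iff_col simp del: upt_Suc)
next
  fix u assume u: "u \<in> D"
  obtain i j where ij: "u = (i, j)" by (cases u)
  then have "j \<in> {1..<Suc ncols}" "i \<in> {1..<Suc (collen lam j)}"
    using u D_col_le[of i j] by (auto simp: D_iff_col)
  then show "u \<in> set (cells lam)" by (auto simp: cells_def ij simp del: upt_Suc intro!: bexI[of _ j])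
qed

lemma cells_suffix:
  assumes "cells lam = pre @ (r, b) # suf"
  shows "(r, b) \<in> D" "suf = cells_from (Suc r) b"
proof -
  show D: "(r, b) \<in> D" using assms set_cells by auto
  obtain pre' where "cells lam = pre' @ (r, b) # cells_from (Suc r) b" using cells_split[OF D] .
  then show "suf = cells_from (Suc r) b"
    using assms distinct_cells by (metis append_Cons_eq_iff distinct.simps(2) distinct_append
        not_distinct_conv_prefix)
qed

text \<open>The induction runs backwards through the cell order, starting from the empty run beyond
  the last column, where all hook values are 0.\<close>

lemma nps_run_bij:
  assumes "1 \<le> r" "r \<le> Suc (collen lam b)" "1 \<le> b" "b \<le> Suc ncols"
  shows "bij_betw (\<lambda>T. nps_run lam (T, \<lambda>_. 0) (rev (cells_from r b))) (tabloids lam) (stage r b)"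
  using assms(4,1,2,3)
proof (induction b arbitrary: r rule: inc_induct)
  case base
  have r: "r = 1" using base collen_beyond by simp
  have reg: "reg 1 (Suc ncols) = {}"
    using D_col_le by (fastforce simp: reg_def)
  have "cand 1 (Suc ncols) H = {}" for H using D_col_le by (fastforce simp: cand_def)
  then have "stage 1 (Suc ncols) = tabloids lam \<times> {\<lambda>_. 0}"
    unfolding stage_def srt_def valid_def reg by (auto simp: fun_eq_iff)
  then show ?case
    using collen_beyond unfolding r
    by (intro bij_betwI[where g = fst]) (auto simp: cells_from_def nps_run_def)
next
  case (step b)
  show ?case
    using step.prems(2,1)
  proof (induction r rule: inc_induct)
    case base
    show ?case
      using step.IH[of 1] step.hyps step.prems(3) stage_next_col[of b] cells_from_next_col[of b] by simp
  next
    case (step r)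
    have rb: "(r, b) \<in> D" using step \<open>1 \<le> b\<close> by (simp add: D_iff_col)
    have "nps_run lam (T, \<lambda>_. 0) (rev (cells_from r b)) =
        nps_step lam (nps_run lam (T, \<lambda>_. 0) (rev (cells_from (Suc r) b))) (r, b)" for T
      using step by (simp add: cells_from_Cons nps_run_def)
    then show ?case
      using bij_betw_trans[OF step.IH nps_step_bij[OF rb]] step by (simp add: comp_def)
  qed
qed

lemma stage_all: "stage 1 1 = SYT lam \<times> hook_tableaux lam"
proof -
  have reg: "reg 1 1 = D" using D_pos by (fastforce simp: reg_def)
  have "srt 1 1 T \<longleftrightarrow> (\<forall>i j. (i, j) \<in> D \<and> (i, Suc j) \<in> D \<longrightarrow> T (i, j) < T (i, Suc j))
    \<and> (\<forall>i j. (i, j) \<in> D \<and> (Suc i, j) \<in> D \<longrightarrow> T (i, j) < T (Suc i, j))" for T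
    unfolding srt_def reg by auto
  moreover have "valid 1 1 H \<longleftrightarrow> H \<in> hook_tableaux lam" for H
    unfolding valid_def hook_tableaux_def reg by auto
  moreover have "entry_col T 1 i (cand_col 1 H i) (1 - 1) = 1"
    if "T \<in> tabloids lam" "i \<in> cand 1 1 H" for T H i
    using entry_col_top[OF that(1), of i] that(2) cand_col_ge by (simp add: cand_def)
  ultimately show ?thesis
    unfolding stage_def SYT_def by auto
qed

definition run :: "(cell \<Rightarrow> nat) \<Rightarrow> cell list \<Rightarrow> cell \<Rightarrow> nat" where
  "run T cs = fst (nps_run lam (T, \<lambda>_. 0) cs)"

lemma run_Nil [simp]: "run T [] = T"
  by (simp add: run_def nps_run_def)

lemma run_snoc [simp]: "run T (cs @ [w]) = fst (slide (sum_list lam) lam (run T cs) w)"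
  by (simp add: run_def nps_run_def nps_step_def Let_def)

text \<open>The definitions skip the slide at the last cell; including it changes nothing.\<close>
lemma nps_run_butlast:
  assumes "cells lam = pre @ zs" "zs \<noteq> []"
  shows "nps_run lam (T, \<lambda>_. 0) (rev (butlast zs)) = nps_run lam (T, \<lambda>_. 0) (rev zs)"
proof -
  obtain ys r b where zs: "zs = ys @ [(r, b)]"
    using assms(2) by (metis append_butlast_last_id surj_pair)
  have D: "(r, b) \<in> D" and nil: "cells_from (Suc r) b = []"
    using cells_suffix[of "pre @ ys" r b "[]"] assms zs by auto
  have "\<not> Suc r \<le> collen lam b" using nil cells_from_Cons by (metis list.distinct(1))
  then have r: "r = collen lam b" using D by (simp add: D_iff_col)
  then have "cells_from 1 (Suc b) = []" using nil cells_from_next_col[of b] D_col_le[OF D] by simp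
  then have "\<not> 1 \<le> collen lam (Suc b)" using cells_from_Cons by (metis list.distinct(1))
  then have "slide (sum_list lam) lam T (r, b) = (T, (r, b))"
    using r by (intro slide_stopI) (auto simp: D_iff_col)
  then have "nps_step lam (T, \<lambda>_. 0) (r, b) = (T, \<lambda>_. 0)"
    by (auto simp: nps_step_def)
  then show ?thesis by (simp add: zs nps_run_def)
qed

lemma Phi_eq:
  assumes "D \<noteq> {}"
  shows "Phi lam T = (snd (nps_run lam (T, \<lambda>_. 0) (rev (cells lam))), run T (rev (cells lam)))"
proof -
  have "cells lam \<noteq> []" using assms set_cells by auto
  then show ?thesis using nps_run_butlast[of "[]"] by (simp add: Phi_def run_def Let_def)
qed

lemma Phi_bij:
  assumes "D \<noteq> {}"
  shows "bij_betw (Phi lam) (tabloids lam) (hook_tableaux lam \<times> SYT lam)"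
proof -
  have "bij_betw (\<lambda>T. nps_run lam (T, \<lambda>_. 0) (rev (cells lam))) (tabloids lam) (SYT lam \<times> hook_tableaux lam)"
    using nps_run_bij[of 1 1] cells_eq[OF assms] stage_all by simp
  moreover have "bij_betw prod.swap (SYT lam \<times> hook_tableaux lam) (hook_tableaux lam \<times> SYT lam)"
    by (intro bij_betwI[where g = prod.swap]) auto
  moreover have "Phi lam = prod.swap \<circ> (\<lambda>T. nps_run lam (T, \<lambda>_. 0) (rev (cells lam)))"
    using Phi_eq[OF assms] by (auto simp: fun_eq_iff run_def prod.swap_def)
  ultimately show ?thesis by (simp only: bij_betw_trans)
qed

lemma nps_state_eq:
  assumes "cells lam = pre @ z # suf"
  shows "nps_state lam T z = run T (rev (z # suf))"
proof -
  have z: "z \<notin> set pre" using distinct_cells assms by simp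
  have "dropWhile (\<lambda>c. c \<noteq> z) (butlast (cells lam)) = butlast (z # suf)"
  proof (cases suf)
    case Nil
    then show ?thesis using z assms by auto
  next
    case (Cons v vs)
    have "dropWhile (\<lambda>c. c \<noteq> z) (pre @ z # butlast suf) = z # butlast suf"
      using z by (subst dropWhile_append2) auto
    then show ?thesis using assms Cons by (simp add: butlast_append)
  qed
  then show ?thesis
    using nps_run_butlast[OF assms] by (simp add: nps_state_def run_def)
qed

end

section \<open>Small and big entries\<close>

text \<open>Equality of the fillings after all values from \<open>k\<close> on have been
  identified.\<close>

definition small_eq :: "nat \<Rightarrow> (cell \<Rightarrow> nat) \<Rightarrow> (cell \<Rightarrow> nat) \<Rightarrow> bool" where
  "small_eq k S T \<longleftrightarrow> (\<forall>c. S c < k \<or> T c < k \<longrightarrow> S c = T c)"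

lemma small_eq_sym: "small_eq k S T \<Longrightarrow> small_eq k T S"
  unfolding small_eq_def by metis

lemma small_eq_trans: "small_eq k S T \<Longrightarrow> small_eq k T U \<Longrightarrow> small_eq k S U"
  unfolding small_eq_def by metis

lemma small_eq_transpose:
  assumes "k \<le> l"
  shows "small_eq k S (transpose k l \<circ> S)"
  using assms by (auto simp: small_eq_def transpose_def)

definition big :: "nat list \<Rightarrow> nat \<Rightarrow> (cell \<Rightarrow> nat) \<Rightarrow> cell set" where
  "big lam k T = {c \<in> diagram lam. k \<le> T c}"

lemma big_cong: "small_eq k S T \<Longrightarrow> big lam k S = big lam k T"
  unfolding small_eq_def big_def by (metis not_less)

lemma big_slide_small:
  assumes "T c < k"
  shows "big lam k (fst (slide f lam T c)) = big lam k T"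
  using assms
proof (induction f arbitrary: T c)
  case (Suc f)
  show ?case
  proof (rule slide_cases[of f lam T c])
    fix y assume y: "T y < T c" and sl: "slide (Suc f) lam T c = slide f lam (T(c := T y, y := T c)) y"
    have "big lam k (T(c := T y, y := T c)) = big lam k T" using y Suc.prems by (auto simp: big_def)
    moreover have "big lam k (fst (slide f lam (T(c := T y, y := T c)) y)) = big lam k (T(c := T y, y := T c))"
      by (rule Suc.IH) (use Suc.prems in simp)
    ultimately show ?thesis using sl by simp
  qed simp
qed simp

text \<open>As the least big value, \<open>k\<close> is exchanged only with small entries, so one
  big cell travels from \<open>c\<close> to \<open>e\<close> and the others stay.\<close>

lemma big_slide_least:
  assumes "T c = k" "c \<in> diagram lam" "slide f lam T c = (S, e)"
  shows "S e = k" "e \<in> diagram lam" "big lam k S = insert e (big lam k T - {c})"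
proof -
  have "S e = k \<and> e \<in> diagram lam \<and> big lam k S = insert e (big lam k T - {c})"
    using assms
  proof (induction f arbitrary: T c)
    case 0
    then show ?case by (auto simp: big_def)
  next
    case (Suc f)
    show ?case
    proof (rule slide_cases[of f lam T c])
      assume "slide (Suc f) lam T c = (T, c)"
      then show ?thesis using Suc.prems by (auto simp: big_def)
    next
      fix y assume y: "adj c y" "y \<in> diagram lam" "T y < T c"
        and sl: "slide (Suc f) lam T c = slide f lam (T(c := T y, y := T c)) y"
      have eq: "big lam k (T(c := T y, y := T c)) - {y} = big lam k T - {c}"
        using y Suc.prems(1) by (auto simp: big_def)
      have sl': "slide f lam (T(c := T y, y := T c)) y = (S, e)" using Suc.prems(3) sl by simp
      have "S e = k \<and> e \<in> diagram lam \<and>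
          big lam k S = insert e (big lam k (T(c := T y, y := T c)) - {y})"
        by (rule Suc.IH[OF _ y(2) sl']) (use Suc.prems in simp)
      then show ?thesis using eq by simp
    qed
  qed
  then show "S e = k" "e \<in> diagram lam" "big lam k S = insert e (big lam k T - {c})" by auto
qed

context young
begin

text \<open>Once both successors are big, sortedness makes everything the entry can still meet big
  as well.\<close>

lemma small_eq_slide_big:
  assumes "asrt r b T c" "T \<in> tabloids lam" "k \<le> T c"
    and "\<And>v. adj c v \<Longrightarrow> v \<in> D \<Longrightarrow> k \<le> T v"
  shows "small_eq k (fst (slide f lam T c)) T"
  using assms
proof (induction f arbitrary: T c)
  case 0
  then show ?case by (simp add: small_eq_def)
next
  case (Suc f)
  show ?case
  proof (rule slide_cases[of f lam T c])
    fix y assume y: "adj c y" "y \<in> D" "T y < T c" "\<And>v. adj c v \<Longrightarrow> v \<in> D \<Longrightarrow> T y \<le> T v"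
      and sl: "slide (Suc f) lam T c = slide f lam (T(c := T y, y := T c)) y"
    let ?T = "T(c := T y, y := T c)"
    have yk: "k \<le> T y" using Suc.prems(4) y by blast
    have ne: "y \<noteq> c" using adj_neq[OF y(1)] by simp
    have c: "c \<in> D" using asrtD(2)[OF Suc.prems(1)] .
    have "small_eq k (fst (slide f lam ?T y)) ?T"
    proof (rule Suc.IH)
      show "asrt r b ?T y" by (rule asrt_move[OF Suc.prems(1,2) y])
      show "?T \<in> tabloids lam" by (rule tabloid_swap[OF Suc.prems(2) c y(2)])
      show "k \<le> ?T y" using Suc.prems(3) by simp
      fix v assume v: "adj y v" "v \<in> D"
      have "v \<noteq> c" "v \<noteq> y" using adj_asym adj_neq v y by blast+
      moreover have "T y < T v"
        using asrtD(3)[OF Suc.prems(1) reg_adj[OF asrtD(1)[OF Suc.prems(1)] y(1,2)] v ne] .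
      ultimately show "k \<le> ?T v" using yk by simp
    qed
    moreover have "small_eq k ?T T" using yk Suc.prems(3) by (simp add: small_eq_def)
    ultimately show ?thesis using sl small_eq_trans by metis
  qed (simp add: small_eq_def)
qed

text \<open>If a small successor is below the moving entry, the least successor is the same small
  entry in both fillings and both slides step there. Otherwise a small moving entry stops in both,
  and a big one has only big entries ahead.\<close>

lemma small_eq_slide:
  assumes "asrt r b S c" "S \<in> tabloids lam" "asrt r b T c" "T \<in> tabloids lam" "small_eq k S T"
  shows "small_eq k (fst (slide f lam S c)) (fst (slide f lam T c))"
  using assms
proof (induction f arbitrary: S T c)
  case (Suc f)
  have eq: "S u = T u" if "S u < k \<or> T u < k" for u
    using Suc.prems(5) that unfolding small_eq_def by blast
  have c: "c \<in> D" using asrtD(2)[OF Suc.prems(1)] .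
  show ?case
  proof (cases "\<exists>v. adj c v \<and> v \<in> D \<and> S v < k \<and> S v < S c")
    case True
    then obtain v where v: "adj c v" "v \<in> D" "S v < k" "S v < S c" by blast
    show ?thesis
    proof (rule slide_cases[of f lam S c])
      assume "\<And>v. adj c v \<Longrightarrow> v \<in> D \<Longrightarrow> S c \<le> S v"
      then show ?thesis using v by (meson not_less)
    next
      fix y assume y: "adj c y" "y \<in> D" "S y < S c" "\<And>v. adj c v \<Longrightarrow> v \<in> D \<Longrightarrow> S y \<le> S v"
        and sl: "slide (Suc f) lam S c = slide f lam (S(c := S y, y := S c)) y"
      have yk: "S y < k" "T y = S y" using y(4)[OF v(1,2)] v(3) eq[of y] by auto
      have lt: "T y < T c" using yk y(3) eq[of c] by (cases "T c < k") auto
      have min: "T y < T u" if "adj c u" "u \<in> D" "u \<noteq> y" for u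
      proof (cases "T u < k")
        case True
        have "S y \<noteq> S u" using inj_onD[OF tabloid_inj[OF Suc.prems(2)]] that y(2) by blast
        then show ?thesis using True eq[of u] y(4)[OF that(1,2)] yk by auto
      qed (use yk in auto)
      have min': "T y \<le> T u" if "adj c u" "u \<in> D" for u using min[OF that] by (cases "u = y") auto
      have "slide (Suc f) lam T c = slide f lam (T(c := T y, y := T c)) y"
        by (rule slide_moveI[OF y(1,2) lt min])
      moreover have "small_eq k (fst (slide f lam (S(c := S y, y := S c)) y))
          (fst (slide f lam (T(c := T y, y := T c)) y))"
      proof (rule Suc.IH)
        show "asrt r b (S(c := S y, y := S c)) y" by (rule asrt_move[OF Suc.prems(1,2) y])
        show "asrt r b (T(c := T y, y := T c)) y" by (rule asrt_move[OF Suc.prems(3,4) y(1,2) lt min'])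
        show "small_eq k (S(c := S y, y := S c)) (T(c := T y, y := T c))"
          using eq yk by (auto simp: small_eq_def)
      qed (intro tabloid_swap Suc.prems c y)+
      ultimately show ?thesis using sl by simp
    qed
  next
    case False
    have noS: "k \<le> S v \<or> S c \<le> S v" if "adj c v" "v \<in> D" for v
      using False that by (meson not_less)
    have noT: "k \<le> T v \<or> T c \<le> T v" if "adj c v" "v \<in> D" for v
      using noS[OF that] eq[of v] eq[of c] by fastforce
    show ?thesis
    proof (cases "S c < k")
      case True
      then have "T c = S c" using eq[of c] by simp
      then have "slide (Suc f) lam S c = (S, c)" "slide (Suc f) lam T c = (T, c)"
        using True noS noT by (intro slide_stopI; fastforce)+
      then show ?thesis using Suc.prems(5) by simp
    next
      case False
      then have k: "k \<le> S c" "k \<le> T c" using eq[of c] by fastforce+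
      have "small_eq k (fst (slide (Suc f) lam S c)) S"
        by (rule small_eq_slide_big[OF Suc.prems(1,2) k(1)]) (use noS k(1) in fastforce)
      moreover have "small_eq k (fst (slide (Suc f) lam T c)) T"
        by (rule small_eq_slide_big[OF Suc.prems(3,4) k(2)]) (use noT k(2) in fastforce)
      ultimately show ?thesis using Suc.prems(5) small_eq_trans small_eq_sym by metis
    qed
  qed
qed simp

lemma run_unchanged:
  assumes "\<forall>u\<in>set cs. \<not> (fst u \<le> fst w \<and> snd u \<le> snd w)"
  shows "run T cs w = T w"
  using assms by (induction cs rule: rev_induct) (auto simp: slide_unchanged)

lemma run_suffix:
  assumes cells: "cells lam = pre @ (r, b) # suf" and T: "T \<in> tabloids lam"
  shows "run T (rev suf) \<in> tabloids lam" "asrt r b (run T (rev suf)) (r, b)"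
    "run T (rev suf) (r, b) = T (r, b)"
proof -
  have D: "(r, b) \<in> D" and suf: "suf = cells_from (Suc r) b" using cells_suffix[OF cells] by auto
  have "nps_run lam (T, \<lambda>_. 0) (rev suf) \<in> stage (Suc r) b"
    using nps_run_bij[of "Suc r" b] D D_col_le[OF D] T unfolding suf
    by (auto simp: D_iff_col dest: bij_betwE)
  then show "run T (rev suf) \<in> tabloids lam" "asrt r b (run T (rev suf)) (r, b)"
    using asrt_start[OF D] by (auto simp: stage_def run_def)
  \<comment> \<open>Earlier slides start at later cells and change only cells weakly southeast of
    their start, never \<open>(r, b)\<close>.\<close>
  show "run T (rev suf) (r, b) = T (r, b)"
    by (rule run_unchanged) (auto simp: suf cells_from_def simp del: upt_Suc)
qed

lemma run_tabloid:
  assumes "cells lam = pre @ suf" "T \<in> tabloids lam"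
  shows "run T (rev suf) \<in> tabloids lam"
proof (cases suf)
  case (Cons w suf')
  obtain r b where w: "w = (r, b)" by (cases w)
  show ?thesis
    using run_suffix(1)[of pre r b suf' T] cells_suffix(1)[of pre r b suf'] assms slide_tabloid
    unfolding Cons w by simp
qed (use assms in simp)

lemma small_eq_run:
  assumes "cells lam = pre @ suf" "S \<in> tabloids lam" "T \<in> tabloids lam" "small_eq k S T"
  shows "small_eq k (run S (rev suf)) (run T (rev suf))"
  using assms
proof (induction suf arbitrary: pre)
  case (Cons w suf)
  obtain r b where w: "w = (r, b)" by (cases w)
  have eq: "small_eq k (run S (rev suf)) (run T (rev suf))"
    using Cons.IH[of "pre @ [w]"] Cons.prems by simp
  note suffix = run_suffix(2,1)[OF Cons.prems(1)[unfolded w]]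
  show ?case
    using small_eq_slide[OF suffix[OF Cons.prems(2)] suffix[OF Cons.prems(3)] eq] w by simp
qed simp

section \<open>Transpositions, big entries and counting\<close>

lemma tabloid_transpose:
  assumes "T \<in> tabloids lam" "1 \<le> k" "k \<le> n" "1 \<le> l" "l \<le> n"
  shows "transpose k l \<circ> T \<in> tabloids lam"
proof -
  have n: "sum_list lam = n" using part by (simp add: is_partition_def)
  have "bij_betw (transpose k l) {1..n} {1..n}"
    using assms by (intro bij_betwI[where g = "transpose k l"]) (auto simp: transpose_def)
  then show ?thesis
    using assms unfolding tabloids_def n by (auto intro!: bij_betw_trans simp: transpose_def)
qed

lemma card_big:
  assumes "T \<in> tabloids lam" "1 \<le> k"
  shows "card (big lam k T) = card {k..n}"
proof -
  have n: "sum_list lam = n" using part by (simp add: is_partition_def)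
  have bij: "bij_betw T D {1..n}" using assms(1) by (simp add: tabloids_def n)
  have "T ` big lam k T = {k..n}"
  proof (intro equalityI subsetI)
    fix v assume "v \<in> T ` big lam k T"
    then show "v \<in> {k..n}" using bij_betwE[OF bij] by (auto simp: big_def)
  next
    fix v assume v: "v \<in> {k..n}"
    then obtain c where "c \<in> D" "T c = v"
      using bij_betw_imp_surj_on[OF bij] assms(2) by (metis atLeastAtMost_iff imageE le_trans)
    then show "v \<in> T ` big lam k T" using v by (auto simp: big_def)
  qed
  moreover have "inj_on T (big lam k T)"
    using bij by (auto simp: bij_betw_def big_def intro: inj_on_subset)
  ultimately show ?thesis using card_image by metis
qed

text \<open>The cell to which the entry \<open>k\<close> is moved if it is put into the cell \<open>z\<close> of \<open>S\<close>.\<close>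
definition target :: "nat \<Rightarrow> (cell \<Rightarrow> nat) \<Rightarrow> cell \<Rightarrow> cell" where
  "target k S z = inv_into D (nps_state lam (transpose k (S z) \<circ> S) z) k"

context
  fixes k :: nat
  assumes k: "1 \<le> k" "k \<le> n"
begin

lemma nps_state_tabloid:
  assumes "T \<in> tabloids lam" "z \<in> D"
  shows "nps_state lam T z \<in> tabloids lam"
proof -
  obtain r b where z: "z = (r, b)" by (cases z)
  obtain pre where "cells lam = pre @ (r, b) # cells_from (Suc r) b"
    using cells_split assms(2) z by blast
  then show ?thesis using run_tabloid[OF _ assms(1)] nps_state_eq z by metis
qed

lemma tabloid_outside: "T \<in> tabloids lam \<Longrightarrow> u \<notin> D \<Longrightarrow> T u = 0"
  by (cases u) (simp add: tabloids_def)

lemma tabloid_le: "S \<in> tabloids lam \<Longrightarrow> S z \<le> n"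
proof -
  assume S: "S \<in> tabloids lam"
  have n: "sum_list lam = n" using part by (simp add: is_partition_def)
  have "S z \<in> {1..n}" if "z \<in> D" using S that by (auto simp: tabloids_def n dest: bij_betwE)
  moreover have "S z = 0" if "z \<notin> D" using tabloid_outside[OF S that] .
  ultimately show "S z \<le> n" by (cases "z \<in> D") auto
qed

lemma target_eqI:
  assumes "S \<in> tabloids lam" "z \<in> big lam k S"
    and "nps_state lam (transpose k (S z) \<circ> S) z e = k"
  shows "target k S z = e"
proof -
  have z: "z \<in> D" "k \<le> S z" using assms(2) by (auto simp: big_def)
  have st: "nps_state lam (transpose k (S z) \<circ> S) z \<in> tabloids lam"
    by (intro nps_state_tabloid tabloid_transpose z) (use assms k z tabloid_le[OF assms(1)] in auto)
  \<comment> \<open>Outside the diagram the value is 0, whereas \<open>k\<close> is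
    positive.\<close>
  have "e \<in> D" using tabloid_outside[OF st, of e] assms(3) k by fastforce
  then show ?thesis
    unfolding target_def using inv_into_f_f[OF tabloid_inj[OF st]] assms(3) by metis
qed

lemma target_state:
  assumes "S \<in> tabloids lam" "z \<in> big lam k S"
  shows "nps_state lam (transpose k (S z) \<circ> S) z (target k S z) = k"
proof -
  have z: "z \<in> D" "k \<le> S z" using assms(2) by (auto simp: big_def)
  have st: "nps_state lam (transpose k (S z) \<circ> S) z \<in> tabloids lam"
    by (intro nps_state_tabloid tabloid_transpose z) (use assms k z tabloid_le[OF assms(1)] in auto)
  have "sum_list lam = n" using part by (simp add: is_partition_def)
  then have "k \<in> nps_state lam (transpose k (S z) \<circ> S) z ` D"
    using st k by (auto simp: tabloids_def bij_betw_def)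
  then show ?thesis unfolding target_def by (rule f_inv_into_f)
qed

text \<open>By \<open>small_eq_slide\<close>, the slide at a cell with a big entry changes the set of cells with big
  entries as if that entry were \<open>k\<close>, which only passes small entries.\<close>
lemma big_run:
  assumes "cells lam = pre @ suf" and S: "S \<in> tabloids lam"
  shows "big lam k (run S (rev suf)) \<subseteq>
    target k S ` (big lam k S \<inter> set suf) \<union> (big lam k S - set suf)"
  using assms(1)
proof (induction suf arbitrary: pre)
  case (Cons w suf)
  obtain r b where w: "w = (r, b)" by (cases w)
  let ?R = "run S (rev suf)"
  have IH: "big lam k ?R \<subseteq> target k S ` (big lam k S \<inter> set suf) \<union> (big lam k S - set suf)"
    using Cons.IH[of "pre @ [w]"] Cons.prems by simp
  have D: "w \<in> D" using cells_suffix(1)[OF Cons.prems[unfolded w]] w by simp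
  note RS = run_suffix[OF Cons.prems[unfolded w], folded w]
  show ?case
  proof (cases "S w < k")
    case True
    then have "big lam k (run S (rev (w # suf))) = big lam k ?R"
      using big_slide_small RS(3)[OF S] by simp
    then show ?thesis using IH True by (auto simp: big_def)
  next
    case False
    let ?T = "transpose k (S w) \<circ> S"
    have wb: "w \<in> big lam k S" using False D by (simp add: big_def)
    have T: "?T \<in> tabloids lam"
      using tabloid_transpose[OF S k] k False tabloid_le[OF S] by simp
    have eq: "small_eq k ?R (run ?T (rev suf))"
      by (rule small_eq_run[of "pre @ [w]"])
        (use Cons.prems S T False in \<open>auto intro: small_eq_transpose\<close>)
    have Tw: "run ?T (rev suf) w = k" using RS(3)[OF T] by simp
    obtain X e where X: "slide (sum_list lam) lam (run ?T (rev suf)) w = (X, e)" by (metis surj_pair)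
    note ls = big_slide_least[OF Tw D X]
    have "nps_state lam ?T w = X" using nps_state_eq[OF Cons.prems] X by simp
    then have e: "e = target k S w" using target_eqI[OF S wb] ls(1) by simp
    have "small_eq k (run S (rev (w # suf))) X"
      using small_eq_slide[OF RS(2,1)[OF S] RS(2,1)[OF T] eq] X by simp (metis fst_conv)
    then have "big lam k (run S (rev (w # suf))) = insert (target k S w) (big lam k ?R - {w})"
      using ls(3) e big_cong eq by metis
    \<comment> \<open>Removing \<open>w\<close> matches its passage from the unprocessed to the
      processed cells. An inclusion suffices, since counting turns it into an equality in
      \<open>target_bij\<close>.\<close>
    then show ?thesis using IH wb by auto
  qed
qed simp

text \<open>Input and output have equally many big cells, and by \<open>big_run\<close> the targets
  cover those of the output. A map onto a set of the same finite size is injective.\<close>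

lemma target_bij:
  assumes S: "S \<in> tabloids lam"
  shows "bij_betw (target k S) (big lam k S) (big lam k (run S (rev (cells lam))))"
proof -
  let ?U = "run S (rev (cells lam))"
  have U: "?U \<in> tabloids lam" using run_tabloid[OF _ S, of "[]"] by simp
  have fin: "finite (big lam k S)" using finite_D by (simp add: big_def)
  have sub: "big lam k ?U \<subseteq> target k S ` big lam k S"
    using big_run[OF _ S, of "[]" "cells lam"] by (auto simp: set_cells big_def)
  have card: "card (big lam k ?U) = card (big lam k S)" using card_big S U k by simp
  have eq: "big lam k ?U = target k S ` big lam k S"
    by (rule card_seteq) (use fin sub card card_image_le[OF fin, of "target k S"] in auto)
  moreover have "inj_on (target k S) (big lam k S)"
    by (rule eq_card_imp_inj_on) (use fin eq card in auto)
  ultimately show ?thesis by (simp add: bij_betw_def)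
qed

text \<open>The cell \<open>z\<close> holding \<open>k\<close> in \<open>T\<close> holds
  \<open>l\<close> in \<open>S\<close>, and swapping back gives \<open>T\<close>. So the preimages
  of \<open>S\<close> correspond to the big cells \<open>z\<close> of \<open>S\<close> with target
  \<open>x\<close>, with \<open>l = S z\<close>; by \<open>target_bij\<close> there is one exactly
  when \<open>x\<close> is big in the output.\<close>

lemma transpose_T_to_bij:
  assumes x: "x \<in> D"
  shows "bij_betw (\<lambda>(T, l). transpose k l \<circ> T) (T_to lam k x \<times> {k..n})
    {S \<in> tabloids lam. k \<le> run S (rev (cells lam)) x}"
proof -
  have invol: "transpose k l \<circ> (transpose k l \<circ> T) = T" for l and T :: "cell \<Rightarrow> nat"
    by (simp add: fun_eq_iff)
  have n: "sum_list lam = n" using part by (simp add: is_partition_def)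
  have key: "\<exists>z. z \<in> big lam k S \<and> S z = l \<and> target k S z = x"
    if T: "T \<in> T_to lam k x" and l: "l \<in> {k..n}" and S: "S = transpose k l \<circ> T" for T l S
  proof -
    have Ttab: "T \<in> tabloids lam" using T by (simp add: T_to_def)
    then have "T ` D = {1..n}" by (simp add: tabloids_def n bij_betw_def)
    then have "k \<in> T ` D" using k by simp
    then obtain z where z: "z \<in> D" "T z = k" by blast
    have Stab: "S \<in> tabloids lam" using tabloid_transpose[OF Ttab k] l k S by simp
    have Sz: "S z = l" using z S by simp
    have "transpose k (S z) \<circ> S = T" using Sz S invol by simp
    moreover have "nps_state lam T z x = k" using T z by (simp add: T_to_def)
    moreover have "z \<in> big lam k S" using z Sz l by (simp add: big_def)
    ultimately show ?thesis using target_eqI[OF Stab] Sz by metis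
  qed
  show ?thesis
    unfolding bij_betw_def
  proof
    show "inj_on (\<lambda>(T, l). transpose k l \<circ> T) (T_to lam k x \<times> {k..n})"
    proof (rule inj_onI, clarify)
      fix T\<^sub>1 l\<^sub>1 T\<^sub>2 l\<^sub>2
      assume T: "T\<^sub>1 \<in> T_to lam k x" "T\<^sub>2 \<in> T_to lam k x" and l: "l\<^sub>1 \<in> {k..n}" "l\<^sub>2 \<in> {k..n}"
        and eq: "transpose k l\<^sub>1 \<circ> T\<^sub>1 = transpose k l\<^sub>2 \<circ> T\<^sub>2"
      let ?S = "transpose k l\<^sub>1 \<circ> T\<^sub>1"
      have S: "?S \<in> tabloids lam" using tabloid_transpose[OF _ k] T(1) l k by (simp add: T_to_def)
      obtain z\<^sub>1 where z1: "z\<^sub>1 \<in> big lam k ?S" "?S z\<^sub>1 = l\<^sub>1" "target k ?S z\<^sub>1 = x"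
        using key[OF T(1) l(1) refl] by blast
      obtain z\<^sub>2 where z2: "z\<^sub>2 \<in> big lam k ?S" "?S z\<^sub>2 = l\<^sub>2" "target k ?S z\<^sub>2 = x"
        using key[OF T(2) l(2) eq] by blast
      have "z\<^sub>1 = z\<^sub>2"
        using bij_betw_imp_inj_on[OF target_bij[OF S]] z1 z2 by (metis inj_onD)
      then have "l\<^sub>1 = l\<^sub>2" using z1 z2 by simp
      then show "T\<^sub>1 = T\<^sub>2 \<and> l\<^sub>1 = l\<^sub>2" using eq invol by metis
    qed
    show "(\<lambda>(T, l). transpose k l \<circ> T) ` (T_to lam k x \<times> {k..n}) =
        {S \<in> tabloids lam. k \<le> run S (rev (cells lam)) x}"
    proof (intro equalityI subsetI)
      fix S assume "S \<in> (\<lambda>(T, l). transpose k l \<circ> T) ` (T_to lam k x \<times> {k..n})"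
      then obtain T l where T: "T \<in> T_to lam k x" "l \<in> {k..n}" "S = transpose k l \<circ> T" by auto
      have S: "S \<in> tabloids lam" using tabloid_transpose[OF _ k] T k by (simp add: T_to_def)
      obtain z where "z \<in> big lam k S" "target k S z = x" using key[OF T] by blast
      then have "x \<in> big lam k (run S (rev (cells lam)))"
        using bij_betwE[OF target_bij[OF S]] by blast
      then show "S \<in> {S \<in> tabloids lam. k \<le> run S (rev (cells lam)) x}" using S by (simp add: big_def)
    next
      fix S assume "S \<in> {S \<in> tabloids lam. k \<le> run S (rev (cells lam)) x}"
      then have S: "S \<in> tabloids lam" and "x \<in> big lam k (run S (rev (cells lam)))"
        using x by (auto simp: big_def)
      then have "x \<in> target k S ` big lam k S"
        using bij_betw_imp_surj_on[OF target_bij[OF S]] by simp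
      then obtain z where z: "z \<in> big lam k S" "target k S z = x" by blast
      let ?T = "transpose k (S z) \<circ> S"
      have zk: "z \<in> D" "k \<le> S z" using z(1) by (auto simp: big_def)
      have T: "?T \<in> tabloids lam" using tabloid_transpose[OF S k] k zk tabloid_le[OF S] by simp
      have "nps_state lam ?T z' x = k" if "z' \<in> D" "?T z' = k" for z'
      proof -
        have "z' = z" using inj_onD[OF tabloid_inj[OF T], of z' z] that zk by simp
        then show ?thesis using target_state[OF S z(1)] z(2) by simp
      qed
      then have "?T \<in> T_to lam k x" using T by (simp add: T_to_def)
      then have "(?T, S z) \<in> T_to lam k x \<times> {k..n}" using zk tabloid_le[OF S] by simp
      then show "S \<in> (\<lambda>(T, l). transpose k l \<circ> T) ` (T_to lam k x \<times> {k..n})"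
        by (rule rev_image_eqI) (simp add: invol)
    qed
  qed
qed

end

end

theorem theorem7:
  fixes lam :: "nat list" and n k :: nat and x :: "nat \<times> nat"
  assumes "is_partition lam n" and "1 \<le> k" and "k \<le> n" and "x \<in> diagram lam"
  shows "bij_betw (\<lambda>(T, l). Phi lam (transpose k l \<circ> T))
           (T_to lam k x \<times> {k..n}) (hook_tableaux lam \<times> SYT_ge lam x k)"
proof -
  interpret young lam n by unfold_locales (rule assms(1))
  have ne: "D \<noteq> {}" using assms(4) by auto
  \<comment> \<open>The preimage of the right-hand side under \<open>Phi\<close>, as the condition
    concerns only the sorted output.\<close>
  let ?A = "{S \<in> tabloids lam. k \<le> run S (rev (cells lam)) x}"
  have bij: "bij_betw (Phi lam) (tabloids lam) (hook_tableaux lam \<times> SYT lam)" by (rule Phi_bij[OF ne])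
  have "Phi lam ` ?A = hook_tableaux lam \<times> SYT_ge lam x k"
  proof (intro equalityI subsetI)
    fix HU assume "HU \<in> Phi lam ` ?A"
    then show "HU \<in> hook_tableaux lam \<times> SYT_ge lam x k"
      using bij_betwE[OF bij] by (auto simp: Phi_eq[OF ne] SYT_ge_def)
  next
    fix HU assume HU: "HU \<in> hook_tableaux lam \<times> SYT_ge lam x k"
    then have "HU \<in> Phi lam ` tabloids lam"
      using bij_betw_imp_surj_on[OF bij] by (auto simp: SYT_ge_def)
    then show "HU \<in> Phi lam ` ?A" using HU by (auto simp: Phi_eq[OF ne] SYT_ge_def)
  qed
  then have "bij_betw (Phi lam) ?A (hook_tableaux lam \<times> SYT_ge lam x k)"
    by (intro bij_betw_subset[OF bij]) auto
  from bij_betw_trans[OF transpose_T_to_bij[OF assms(2-4)] this] show ?thesis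
    by (simp add: comp_def case_prod_unfold)
qed

end
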